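(* With the notation and standing assumptions of the context (in particular $\mathbb{F}$ has characteristic $0$, the Lie algebra $({\cal A}_2,[\cdot,\cdot]_1)$ is built from $\Gamma,\varphi_1,\varphi_2,{\cal J}_1,{\cal J}_2$, and ${\cal B}_2={\cal A}_2/\mathbb{F}x^{\sigma_1,\vec 0}$), the following hold. (a) If $\vec{\cal J}\neq\{\vec 0\}$ or $\sigma_2$ does not exist, then the Lie algebra $({\cal B}_2,[\cdot,\cdot]_1)$ is simple. (b) If $\vec{\cal J}=\{\vec 0\}$ and $\sigma_2$ exists, then ${\cal B}_2^{(1)}=[{\cal B}_2,{\cal B}_2]_1$ is a simple Lie algebra and $${\cal B}_2={\cal B}_2^{(1)}\oplus(\mathbb{F}x^{\sigma_2,\vec 0}+\mathbb{F}x^{\sigma_1,\vec 0})$$ as vector spaces, where the elements $x^{\sigma_i,\vec 0}$ on the right-hand side denote their images in the quotient ${\cal B}_2$ (so the image of $x^{\sigma_1,\vec 0}$ is $0$).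
   Context: $\mathbb{F}$ is a field of characteristic $0$, all vector spaces are over $\mathbb{F}$, and $\mathbb{N}=\{0,1,2,\dots\}$. Let $\Gamma$ be a torsion-free abelian group ($\Gamma=\{0\}$ is allowed). For $p\in\{1,2\}$ let ${\cal J}_p\in\{\{0\},\mathbb{N}\}$ (i.e. ${\cal J}_p$ is either $\{0\}$ or $\mathbb{N}$), and let $\varphi_p:\Gamma\to\mathbb{F}$ be additive group homomorphisms such that - $\varphi_p\not\equiv 0$ whenever ${\cal J}_p=\{0\}$, for $p=1,2$; - $\ker\varphi_1\cap\ker\varphi_2=\{0\}$. Put $\vec{\cal J}={\cal J}_1\times{\cal J}_2$ with componentwise addition, write $\vec i=(i_1,i_2)$ and $\vec 0=(0,0)$, and set $1_{[1]}=(1,0)$, $1_{[2]}=(0,1)$. Let ${\cal A}_2$ be the vector space with basis $\{x^{\alpha,\vec i}\mid(\alpha,\vec i)\in\Gamma\times\vec{\cal J}\}$. It is a commutative associative algebra with product $x^{\alpha,\vec i}\cdot x^{\beta,\vec j}=x^{\alpha+\beta,\vec i+\vec j}$ and identity $1=x^{0,\vec 0}$. For $p=1,2$ let $\partial_p$ be the derivation of ${\cal A}_2$ given by $$\partial_p(x^{\alpha,\vec i})=\varphi_p(\alpha)x^{\alpha,\vec i}+i_p\,x^{\alpha,\vec i-1_{[p]}},$$ where a symbol $x^{\alpha,\vec l}$ with $\vec l\notin\vec{\cal J}$ is treated as zero. Define the bracket $$[u,v]_1=\partial_1(u)\partial_2(v)-\partial_1(v)\partial_2(u)+u\,\partial_1(v)-\partial_1(u)\,v\qquad(u,v\in{\cal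 A}_2).$$ Then $({\cal A}_2,[\cdot,\cdot]_1)$ is a Lie algebra. For $i\in\{1,2\}$, $\sigma_i$ denotes the element of $\ker\varphi_1$ with $\varphi_2(\sigma_i)=i$, if such an element exists; it is then unique because $\ker\varphi_1\cap\ker\varphi_2=\{0\}$. If $\sigma_i$ does not exist, $x^{\sigma_i,\vec 0}$ is understood to be $0\in{\cal A}_2$. If $\sigma_1$ exists, $x^{\sigma_1,\vec 0}$ is central in $({\cal A}_2,[\cdot,\cdot]_1)$. Let ${\cal B}_2={\cal A}_2/\mathbb{F}x^{\sigma_1,\vec 0}$ be the quotient Lie algebra, with induced bracket still denoted $[\cdot,\cdot]_1$. *)

theory Defs
  imports
    Complex_Main
    "HOL-Algebra.Module"
    "HOL-Algebra.AbelCoset"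
    "HOL-Library.Poly_Mapping"
    "HOL-Library.Product_Plus"
begin

section \<open>Lie algebras over a field\<close>

text \<open>
  A Lie algebra is a module over a field with an additional bracket operation. The fields
  \<open>mult\<close> and \<open>one\<close>, which \<open>module\<close> records inherit from \<open>ring\<close>, are irrelevant here:
  no definition in this section depends on them.
\<close>

record ('a, 'b) lie = "('a, 'b) module" +
  bracket :: "'b \<Rightarrow> 'b \<Rightarrow> 'b"

locale lie_algebra = field R + module R L
  for R :: "('a, 'r) ring_scheme" (structure) and L :: "('a, 'b, 'm) lie_scheme" (structure) +
  assumes bracket_closed:
      "\<lbrakk>x \<in> carrier L; y \<in> carrier L\<rbrakk> \<Longrightarrow> bracket L x y \<in> carrier L"
    and bracket_add_left:
      "\<lbrakk>x \<in> carrier L; y \<in> carrier L; z \<in> carrier L\<rbrakk> \<Longrightarrow>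
        bracket L (x \<oplus>\<^bsub>L\<^esub> y) z = bracket L x z \<oplus>\<^bsub>L\<^esub> bracket L y z"
    and bracket_add_right:
      "\<lbrakk>x \<in> carrier L; y \<in> carrier L; z \<in> carrier L\<rbrakk> \<Longrightarrow>
        bracket L x (y \<oplus>\<^bsub>L\<^esub> z) = bracket L x y \<oplus>\<^bsub>L\<^esub> bracket L x z"
    and bracket_smult_left:
      "\<lbrakk>c \<in> carrier R; x \<in> carrier L; y \<in> carrier L\<rbrakk> \<Longrightarrow>
        bracket L (c \<odot>\<^bsub>L\<^esub> x) y = c \<odot>\<^bsub>L\<^esub> bracket L x y"
    and bracket_smult_right:
      "\<lbrakk>c \<in> carrier R; x \<in> carrier L; y \<in> carrier L\<rbrakk> \<Longrightarrow>
        bracket L x (c \<odot>\<^bsub>L\<^esub> y) = c \<odot>\<^bsub>L\<^esub> bracket L x y"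
    and bracket_self:
      "x \<in> carrier L \<Longrightarrow> bracket L x x = \<zero>\<^bsub>L\<^esub>"
    and jacobi:
      "\<lbrakk>x \<in> carrier L; y \<in> carrier L; z \<in> carrier L\<rbrakk> \<Longrightarrow>
        bracket L x (bracket L y z) \<oplus>\<^bsub>L\<^esub> bracket L y (bracket L z x)
          \<oplus>\<^bsub>L\<^esub> bracket L z (bracket L x y) = \<zero>\<^bsub>L\<^esub>"

definition lie_ideal ::
    "'b set \<Rightarrow> ('a, 'r) ring_scheme \<Rightarrow> ('a, 'b, 'm) lie_scheme \<Rightarrow> bool" where
  "lie_ideal I R L \<longleftrightarrow>
    submodule I R L \<and> (\<forall>x\<in>carrier L. \<forall>y\<in>I. bracket L x y \<in> I)"

definition simple_lie_algebra ::
    "('a, 'r) ring_scheme \<Rightarrow> ('a, 'b, 'm) lie_scheme \<Rightarrow> bool" where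
  "simple_lie_algebra R L \<longleftrightarrow>
    lie_algebra R L \<and>
    (\<exists>x\<in>carrier L. \<exists>y\<in>carrier L. bracket L x y \<noteq> \<zero>\<^bsub>L\<^esub>) \<and>
    (\<forall>I. lie_ideal I R L \<longrightarrow> I = {\<zero>\<^bsub>L\<^esub>} \<or> I = carrier L)"

text \<open>The linear span \<open>[L, L]\<close> of all brackets.\<close>

definition lie_derived ::
    "('a, 'r) ring_scheme \<Rightarrow> ('a, 'b, 'm) lie_scheme \<Rightarrow> 'b set" where
  "lie_derived R L =
    \<Inter>{H. submodule H R L \<and> (\<forall>x\<in>carrier L. \<forall>y\<in>carrier L. bracket L x y \<in> H)}"

definition lie_derived_algebra ::
    "('a, 'r) ring_scheme \<Rightarrow> ('a, 'b, 'm) lie_scheme \<Rightarrow> ('a, 'b, 'm) lie_scheme" where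
  "lie_derived_algebra R L = L\<lparr>carrier := lie_derived R L\<rparr>"

text \<open>
  The quotient by an ideal, in the style of \<open>FactRing\<close>: the elements are the cosets
  \<open>I +> x\<close>, and scalar multiplication and bracket are computed on representatives.
\<close>

definition lie_quotient :: "('a, 'b, 'm) lie_scheme \<Rightarrow> 'b set \<Rightarrow> ('a, 'b set) lie" where
  "lie_quotient L I =
    \<lparr>carrier = a_rcosets\<^bsub>L\<^esub> I, mult = undefined, one = undefined,
     zero = I, add = set_add L,
     smult = (\<lambda>c X. \<Union>x\<in>X. I +>\<^bsub>L\<^esub> (c \<odot>\<^bsub>L\<^esub> x)),
     bracket = (\<lambda>X Y. \<Union>x\<in>X. \<Union>y\<in>Y. I +>\<^bsub>L\<^esub> bracket L x y)\<rparr>"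

definition is_direct_sum ::
    "('a, 'r) ring_scheme \<Rightarrow> ('a, 'b, 'm) module_scheme \<Rightarrow> 'b set \<Rightarrow> 'b set \<Rightarrow> bool" where
  "is_direct_sum R M U V \<longleftrightarrow>
    submodule U R M \<and> submodule V R M \<and> carrier M = U <+>\<^bsub>M\<^esub> V \<and> U \<inter> V = {\<zero>\<^bsub>M\<^esub>}"

text \<open>A type-class field, regarded as a ring record.\<close>

definition field_of :: "'k::field itself \<Rightarrow> 'k ring" where
  "field_of _ = \<lparr>carrier = UNIV, mult = (*), one = 1, zero = 0, add = (+)\<rparr>"


section \<open>The algebra \<open>A\<^sub>2\<close> and its bracket\<close>

text \<open>
  The monomial \<open>x\<^bsup>\<alpha>,(i,j)\<^esup>\<close> is \<open>single (\<alpha>, i, j) 1\<close>. The product of the type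
  \<open>'g \<times> nat \<times> nat \<Rightarrow>\<^sub>0 'k\<close> is convolution, so monomials multiply by adding exponents
  componentwise.
\<close>

definition xmon :: "'g \<Rightarrow> nat \<Rightarrow> nat \<Rightarrow> 'g \<times> nat \<times> nat \<Rightarrow>\<^sub>0 'k::field" where
  "xmon \<alpha> i j = Poly_Mapping.single (\<alpha>, i, j) 1"

definition scale :: "'k \<Rightarrow> ('b \<Rightarrow>\<^sub>0 'k) \<Rightarrow> 'b \<Rightarrow>\<^sub>0 'k::field" where
  "scale c u = Poly_Mapping.map ((*) c) u"

definition lin_ext :: "('b \<Rightarrow> 'b \<Rightarrow>\<^sub>0 'k) \<Rightarrow> ('b \<Rightarrow>\<^sub>0 'k) \<Rightarrow> 'b \<Rightarrow>\<^sub>0 'k::field" where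
  "lin_ext f u = (\<Sum>b\<in>Poly_Mapping.keys u. scale (Poly_Mapping.lookup u b) (f b))"

text \<open>
  When \<open>i = 0\<close>, the monomial with exponent \<open>i - 1\<close> (truncated to \<open>0\<close>) has
  coefficient \<open>0\<close>; when \<open>i > 0\<close>, the exponent set containing \<open>i\<close> is all of the naturals.
  So the convention that monomials with inadmissible exponents vanish is respected.
\<close>

definition d1 :: "('g \<Rightarrow> 'k) \<Rightarrow> ('g \<times> nat \<times> nat \<Rightarrow>\<^sub>0 'k) \<Rightarrow> 'g \<times> nat \<times> nat \<Rightarrow>\<^sub>0 'k::field" where
  "d1 \<phi>1 = lin_ext (\<lambda>(\<alpha>, i, j).
     scale (\<phi>1 \<alpha>) (xmon \<alpha> i j) + scale (of_nat i) (xmon \<alpha> (i - 1) j))"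

definition d2 :: "('g \<Rightarrow> 'k) \<Rightarrow> ('g \<times> nat \<times> nat \<Rightarrow>\<^sub>0 'k) \<Rightarrow> 'g \<times> nat \<times> nat \<Rightarrow>\<^sub>0 'k::field" where
  "d2 \<phi>2 = lin_ext (\<lambda>(\<alpha>, i, j).
     scale (\<phi>2 \<alpha>) (xmon \<alpha> i j) + scale (of_nat j) (xmon \<alpha> i (j - 1)))"

definition bracket1 ::
    "('g \<Rightarrow> 'k) \<Rightarrow> ('g \<Rightarrow> 'k) \<Rightarrow> ('g::ab_group_add \<times> nat \<times> nat \<Rightarrow>\<^sub>0 'k) \<Rightarrow>
     ('g \<times> nat \<times> nat \<Rightarrow>\<^sub>0 'k) \<Rightarrow> 'g \<times> nat \<times> nat \<Rightarrow>\<^sub>0 'k::field" where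
  "bracket1 \<phi>1 \<phi>2 u v =
     d1 \<phi>1 u * d2 \<phi>2 v - d1 \<phi>1 v * d2 \<phi>2 u + u * d1 \<phi>1 v - d1 \<phi>1 u * v"

definition A2 ::
    "('g::ab_group_add \<Rightarrow> 'k::field) \<Rightarrow> ('g \<Rightarrow> 'k) \<Rightarrow> nat set \<Rightarrow> nat set \<Rightarrow>
     ('k, 'g \<times> nat \<times> nat \<Rightarrow>\<^sub>0 'k) lie" where
  "A2 \<phi>1 \<phi>2 J1 J2 =
    \<lparr>carrier = {u. Poly_Mapping.keys u \<subseteq> UNIV \<times> J1 \<times> J2}, mult = (*), one = 1,
     zero = 0, add = (+), smult = scale, bracket = bracket1 \<phi>1 \<phi>2\<rparr>"


section \<open>The elements \<open>\<sigma>\<^sub>i\<close> and the quotient \<open>B\<^sub>2\<close>\<close>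

definition is_sigma ::
    "('g \<Rightarrow> 'k::field) \<Rightarrow> ('g \<Rightarrow> 'k) \<Rightarrow> nat \<Rightarrow> 'g \<Rightarrow> bool" where
  "is_sigma \<phi>1 \<phi>2 i \<sigma> \<longleftrightarrow> \<phi>1 \<sigma> = 0 \<and> \<phi>2 \<sigma> = of_nat i"

text \<open>
  The description is meaningful because \<open>\<sigma>\<^sub>i\<close> is unique if it exists, the kernels of
  \<open>\<phi>1\<close> and \<open>\<phi>2\<close> having trivial intersection.
\<close>

definition xsigma ::
    "('g \<Rightarrow> 'k) \<Rightarrow> ('g \<Rightarrow> 'k) \<Rightarrow> nat \<Rightarrow> 'g \<times> nat \<times> nat \<Rightarrow>\<^sub>0 'k::field" where
  "xsigma \<phi>1 \<phi>2 i =
    (if \<exists>\<sigma>. is_sigma \<phi>1 \<phi>2 i \<sigma> then xmon (THE \<sigma>. is_sigma \<phi>1 \<phi>2 i \<sigma>) 0 0 else 0)"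

definition center_line ::
    "('g \<Rightarrow> 'k) \<Rightarrow> ('g \<Rightarrow> 'k) \<Rightarrow> ('g \<times> nat \<times> nat \<Rightarrow>\<^sub>0 'k::field) set" where
  "center_line \<phi>1 \<phi>2 = range (\<lambda>c. scale c (xsigma \<phi>1 \<phi>2 1))"

definition B2 ::
    "('g::ab_group_add \<Rightarrow> 'k::field) \<Rightarrow> ('g \<Rightarrow> 'k) \<Rightarrow> nat set \<Rightarrow> nat set \<Rightarrow>
     ('k, ('g \<times> nat \<times> nat \<Rightarrow>\<^sub>0 'k) set) lie" where
  "B2 \<phi>1 \<phi>2 J1 J2 = lie_quotient (A2 \<phi>1 \<phi>2 J1 J2) (center_line \<phi>1 \<phi>2)"

text \<open>The image of \<open>u\<close> in the quotient.\<close>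

definition B2_class ::
    "('g::ab_group_add \<Rightarrow> 'k::field) \<Rightarrow> ('g \<Rightarrow> 'k) \<Rightarrow> nat set \<Rightarrow> nat set \<Rightarrow>
     ('g \<times> nat \<times> nat \<Rightarrow>\<^sub>0 'k) \<Rightarrow> ('g \<times> nat \<times> nat \<Rightarrow>\<^sub>0 'k) set" where
  "B2_class \<phi>1 \<phi>2 J1 J2 u = center_line \<phi>1 \<phi>2 +>\<^bsub>A2 \<phi>1 \<phi>2 J1 J2\<^esub> u"

text \<open>The subspace spanned by the images of \<open>x\<^bsup>\<sigma>\<^sub>2,0\<^esup>\<close> and \<open>x\<^bsup>\<sigma>\<^sub>1,0\<^esup>\<close>.\<close>

definition sigma_span ::
    "('g::ab_group_add \<Rightarrow> 'k::field) \<Rightarrow> ('g \<Rightarrow> 'k) \<Rightarrow> nat set \<Rightarrow> nat set \<Rightarrow>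
     ('g \<times> nat \<times> nat \<Rightarrow>\<^sub>0 'k) set set" where
  "sigma_span \<phi>1 \<phi>2 J1 J2 =
    {smult (B2 \<phi>1 \<phi>2 J1 J2) a (B2_class \<phi>1 \<phi>2 J1 J2 (xsigma \<phi>1 \<phi>2 2))
       \<oplus>\<^bsub>B2 \<phi>1 \<phi>2 J1 J2\<^esub>
     smult (B2 \<phi>1 \<phi>2 J1 J2) b (B2_class \<phi>1 \<phi>2 J1 J2 (xsigma \<phi>1 \<phi>2 1)) | a b. True}"

end

theory Submission
  imports Defs
begin

text \<open>
  The bracket is \<open>[u, v] = \<partial>\<^sub>1 u (\<partial>\<^sub>2 v - v) - \<partial>\<^sub>1 v (\<partial>\<^sub>2 u - u)\<close>, so \<open>[1, v] = \<partial>\<^sub>1 v\<close>, and an ideal \<open>K\<close> properly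
  containing the central line is \<open>\<partial>\<^sub>1\<close>-stable. As \<open>\<partial>\<^sub>1\<close> is locally annihilated by split polynomials, \<open>K\<close>
  contains a noncentral eigenvector of \<open>\<partial>\<^sub>1\<close>, and bracketing it with a monomial of opposite weight gives
  a noncentral \<open>f\<close> with \<open>\<partial>\<^sub>1 f = 0\<close>. Then \<open>[v, f] = \<partial>\<^sub>1 v h\<close> with \<open>h = \<partial>\<^sub>2 f - f \<noteq> 0\<close>, so that the
  \<open>\<partial>\<^sub>1\<close>-constants \<open>h\<close> with \<open>\<partial>\<^sub>1 A h \<subseteq> K\<close> form a nonzero associative ideal. It is \<open>\<partial>\<^sub>2\<close>-stable, and the
  \<open>\<partial>\<^sub>1\<close>-constants have no proper nonzero \<open>\<partial>\<^sub>2\<close>-stable ideal, because a joint eigenvector of \<open>\<partial>\<^sub>1\<close> and \<open>\<partial>\<^sub>2\<close>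
  is a multiple of an invertible monomial. Hence \<open>\<partial>\<^sub>1 A \<subseteq> K\<close>. This is everything when \<open>\<partial>\<^sub>1\<close> is surjective;
  otherwise the remaining \<open>\<partial>\<^sub>1\<close>-constants arise from brackets of opposite weights \<open>a\<close>, \<open>-a\<close>, which
  are the elements \<open>-a (\<partial>\<^sub>2 - 2) u\<close>. The image of \<open>\<partial>\<^sub>2 - 2\<close> misses exactly \<open>x\<^bsup>\<sigma>\<^sub>2\<^esup>\<close>, and only when both exponent
  sets are \<open>{0}\<close>.
\<close>

section \<open>Subalgebras and quotients of Lie algebras\<close>

text \<open>Negatives come from the scalar -1, so subspaces can be handled through closure
  conditions alone.\<close>

lemma (in module) submodule_iff:
  "submodule H R M \<longleftrightarrow> H \<subseteq> carrier M \<and> \<zero>\<^bsub>M\<^esub> \<in> H \<and> (\<forall>x\<in>H. \<forall>y\<in>H. x \<oplus>\<^bsub>M\<^esub> y \<in> H) \<and>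
    (\<forall>c\<in>carrier R. \<forall>x\<in>H. c \<odot>\<^bsub>M\<^esub> x \<in> H)" (is "_ \<longleftrightarrow> ?R")
proof
  assume H: "submodule H R M"
  obtain x where "x \<in> H" using submoduleE(2)[OF H] by blast
  then have "\<zero> \<odot>\<^bsub>M\<^esub> x \<in> H" "x \<in> carrier M" using submoduleE(1,4)[OF H] by auto
  then have "\<zero>\<^bsub>M\<^esub> \<in> H" by simp
  then show ?R using submoduleE[OF H] by auto
next
  assume H: ?R
  show "submodule H R M"
  proof (rule submoduleI)
    fix a assume "a \<in> H"
    then have "(\<ominus> \<one>) \<odot>\<^bsub>M\<^esub> a \<in> H" "a \<in> carrier M" using H by auto
    then show "\<ominus>\<^bsub>M\<^esub> a \<in> H" by (simp add: smult_l_minus)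
  qed (use H in auto)
qed

lemma lie_subalgebra:
  fixes L :: "('a, 'b, 'm) lie_scheme"
  assumes "lie_algebra R L" "submodule M R L"
    and closed: "\<And>x y. x \<in> M \<Longrightarrow> y \<in> M \<Longrightarrow> bracket L x y \<in> M"
  shows "lie_algebra R (L\<lparr>carrier := M\<rparr>)"
proof -
  interpret lie_algebra R L by fact
  have M: "M \<subseteq> carrier L" using submoduleE(1)[OF assms(2)] .
  interpret M: module R "L\<lparr>carrier := M\<rparr>" by (rule submodule.submodule_is_module[OF assms(2) module_axioms])
  show ?thesis
    by unfold_locales
      (use M closed in \<open>simp_all add: subsetD bracket_add_left bracket_add_right bracket_smult_left
        bracket_smult_right bracket_self jacobi\<close>)
qed

section \<open>The quotient of a Lie algebra by an ideal, computed on classes\<close>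

locale lie_algebra_ideal = lie_algebra +
  fixes I
  assumes lie_ideal_I: "lie_ideal I R L"
begin

abbreviation Q where "Q \<equiv> lie_quotient L I"
abbreviation cls where "cls x \<equiv> I +>\<^bsub>L\<^esub> x"

lemma submodule_I: "submodule I R L"
  using lie_ideal_I by (simp add: lie_ideal_def)

lemma I_closed:
  "x \<in> I \<Longrightarrow> x \<in> carrier L" "\<zero>\<^bsub>L\<^esub> \<in> I" "x \<in> I \<Longrightarrow> y \<in> I \<Longrightarrow> x \<oplus>\<^bsub>L\<^esub> y \<in> I"
  "c \<in> carrier R \<Longrightarrow> x \<in> I \<Longrightarrow> c \<odot>\<^bsub>L\<^esub> x \<in> I"
  "x \<in> carrier L \<Longrightarrow> y \<in> I \<Longrightarrow> bracket L x y \<in> I"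
  using lie_ideal_I unfolding lie_ideal_def submodule_iff by auto

sublocale I: abelian_subgroup I L
proof (rule abelian_subgroupI3)
  show "additive_subgroup I L"
    using submodule.axioms(1)[OF submodule_I] by (rule additive_subgroupI)
  show "abelian_group L" ..
qed

text \<open>Polarisation: expanding the vanishing bracket of \<open>y \<oplus> x\<close> with itself
  leaves only the two mixed terms.\<close>

lemma bracket_antisym:
  assumes "x \<in> carrier L" "y \<in> carrier L"
  shows "bracket L y x = \<ominus>\<^bsub>L\<^esub> bracket L x y"
proof -
  have "bracket L y x \<oplus>\<^bsub>L\<^esub> bracket L x y =
      bracket L y (y \<oplus>\<^bsub>L\<^esub> x) \<oplus>\<^bsub>L\<^esub> bracket L x (y \<oplus>\<^bsub>L\<^esub> x)"
    using assms by (simp add: bracket_add_right bracket_self bracket_closed)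
  also have "\<dots> = bracket L (y \<oplus>\<^bsub>L\<^esub> x) (y \<oplus>\<^bsub>L\<^esub> x)"
    using assms by (intro bracket_add_left[symmetric]) simp_all
  also have "\<dots> = \<zero>\<^bsub>L\<^esub>"
    using assms by (intro bracket_self) simp
  finally show ?thesis
    using assms by (intro M.minus_equality[symmetric]) (simp_all add: bracket_closed)
qed

lemma bracket_I_left: "x \<in> I \<Longrightarrow> y \<in> carrier L \<Longrightarrow> bracket L x y \<in> I"
  using bracket_antisym[of y x] I_closed by simp

lemma cls_absorb: "h \<in> I \<Longrightarrow> x \<in> carrier L \<Longrightarrow> cls (h \<oplus>\<^bsub>L\<^esub> x) = cls x"
  by (metis I.a_repr_independence' a_rcosI I_closed(1) I.a_subset)

lemma cls_self: "x \<in> carrier L \<Longrightarrow> x \<in> cls x"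
  by (rule I.a_rcos_self)

lemma cls_memE:
  assumes "y \<in> cls x"
  obtains h where "h \<in> I" "y = h \<oplus>\<^bsub>L\<^esub> x"
  using assms unfolding a_r_coset_def' by blast

lemma cls_zero: "cls \<zero>\<^bsub>L\<^esub> = I"
  using I.a_subset by simp

lemma cls_eq_I_iff: "x \<in> carrier L \<Longrightarrow> cls x = I \<longleftrightarrow> x \<in> I"
  using cls_self[of x] cls_absorb[of x "\<zero>\<^bsub>L\<^esub>"] cls_zero by auto

lemma carrier_Q: "carrier Q = cls ` carrier L"
  by (auto simp: lie_quotient_def A_RCOSETS_def')

lemma zero_Q: "\<zero>\<^bsub>Q\<^esub> = cls \<zero>\<^bsub>L\<^esub>"
  by (simp add: lie_quotient_def cls_zero del: a_coset_add_zero)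

lemma add_Q: "x \<in> carrier L \<Longrightarrow> y \<in> carrier L \<Longrightarrow> cls x \<oplus>\<^bsub>Q\<^esub> cls y = cls (x \<oplus>\<^bsub>L\<^esub> y)"
  by (simp add: lie_quotient_def I.a_rcos_sum)

text \<open>The union in \<open>lie_quotient\<close> runs over equal cosets: replacing
  \<open>x\<close> by \<open>h \<oplus> x\<close> with \<open>h\<close> in \<open>I\<close> changes
  the multiple by an element of \<open>I\<close>.\<close>

lemma smult_Q:
  assumes "c \<in> carrier R" "x \<in> carrier L"
  shows "c \<odot>\<^bsub>Q\<^esub> cls x = cls (c \<odot>\<^bsub>L\<^esub> x)"
proof -
  have "cls (c \<odot>\<^bsub>L\<^esub> y) = cls (c \<odot>\<^bsub>L\<^esub> x)" if "y \<in> cls x" for y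
    using that assms by (elim cls_memE) (simp add: smult_r_distr I_closed cls_absorb)
  then have "(\<Union>y\<in>cls x. cls (c \<odot>\<^bsub>L\<^esub> y)) = cls (c \<odot>\<^bsub>L\<^esub> x)"
    using cls_self[OF assms(2)] by blast
  then show ?thesis by (simp add: lie_quotient_def)
qed

text \<open>Independence of representatives: [h + x, g + y] = [h, g + y] + [x, g] + [x, y], and the
  first two terms lie in the ideal \<open>I\<close>.\<close>

lemma bracket_Q:
  assumes "x \<in> carrier L" "y \<in> carrier L"
  shows "bracket Q (cls x) (cls y) = cls (bracket L x y)"
proof -
  have "cls (bracket L x' y') = cls (bracket L x y)" if xy: "x' \<in> cls x" "y' \<in> cls y" for x' y'
  proof -
    obtain h where h: "h \<in> I" "x' = h \<oplus>\<^bsub>L\<^esub> x" using xy(1) by (rule cls_memE)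
    obtain g where g: "g \<in> I" "y' = g \<oplus>\<^bsub>L\<^esub> y" using xy(2) by (rule cls_memE)
    have "bracket L x' y' = bracket L h y' \<oplus>\<^bsub>L\<^esub> (bracket L x g \<oplus>\<^bsub>L\<^esub> bracket L x y)"
    proof -
      have "y' \<in> carrier L" using assms g I_closed(1) by simp
      then have "bracket L x' y' = bracket L h y' \<oplus>\<^bsub>L\<^esub> bracket L x y'"
        using assms h I_closed(1) by (simp add: bracket_add_left)
      also have "bracket L x y' = bracket L x g \<oplus>\<^bsub>L\<^esub> bracket L x y"
        using assms g I_closed(1) by (simp add: bracket_add_right)
      finally show ?thesis .
    qed
    moreover have "bracket L h y' \<in> I" "bracket L x g \<in> I"
      using assms h g by (simp_all add: bracket_I_left I_closed)
    ultimately show ?thesis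
      using assms by (simp add: cls_absorb I_closed(1) bracket_closed)
  qed
  then have "(\<Union>x'\<in>cls x. \<Union>y'\<in>cls y. cls (bracket L x' y')) = cls (bracket L x y)"
    using cls_self[OF assms(1)] cls_self[OF assms(2)] by blast
  then show ?thesis by (simp add: lie_quotient_def)
qed

lemma lie_algebra_Q: "lie_algebra R Q"
proof -
  note Q = add_Q smult_Q bracket_Q zero_Q
  interpret Q: module R Q
  proof (rule moduleI)
    show "abelian_group Q"
    proof (rule abelian_groupI; unfold carrier_Q; clarify?)
      fix x y assume "x \<in> carrier L" "y \<in> carrier L"
      then show "cls x \<oplus>\<^bsub>Q\<^esub> cls y \<in> cls ` carrier L" by (simp add: Q)
    next
      show "\<zero>\<^bsub>Q\<^esub> \<in> cls ` carrier L" by (simp add: Q del: a_coset_add_zero)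
    next
      fix x y z assume "x \<in> carrier L" "y \<in> carrier L" "z \<in> carrier L"
      then show "cls x \<oplus>\<^bsub>Q\<^esub> cls y \<oplus>\<^bsub>Q\<^esub> cls z = cls x \<oplus>\<^bsub>Q\<^esub> (cls y \<oplus>\<^bsub>Q\<^esub> cls z)"
        by (simp add: Q M.add.m_assoc)
    next
      fix x y assume "x \<in> carrier L" "y \<in> carrier L"
      then show "cls x \<oplus>\<^bsub>Q\<^esub> cls y = cls y \<oplus>\<^bsub>Q\<^esub> cls x" by (simp add: Q M.add.m_comm)
    next
      fix x assume "x \<in> carrier L"
      then show "\<zero>\<^bsub>Q\<^esub> \<oplus>\<^bsub>Q\<^esub> cls x = cls x" by (simp add: Q del: a_coset_add_zero)
    next
      fix x assume "x \<in> carrier L"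
      then have "cls (\<ominus>\<^bsub>L\<^esub> x) \<oplus>\<^bsub>Q\<^esub> cls x = \<zero>\<^bsub>Q\<^esub>" by (simp add: Q M.l_neg)
      then show "\<exists>y\<in>cls ` carrier L. y \<oplus>\<^bsub>Q\<^esub> cls x = \<zero>\<^bsub>Q\<^esub>"
        using \<open>x \<in> carrier L\<close> by auto
    qed
  next
    show "cring R" ..
  qed (auto simp: carrier_Q Q smult_l_distr smult_r_distr smult_assoc1)
  show ?thesis
    by unfold_locales
      (auto simp: carrier_Q Q bracket_closed bracket_add_left bracket_add_right bracket_smult_left
        bracket_smult_right bracket_self jacobi simp del: a_coset_add_zero)
qed

lemma submodule_cls_image:
  assumes "submodule H R L"
  shows "submodule (cls ` H) R Q"
proof -
  interpret Q: lie_algebra R Q by (rule lie_algebra_Q)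
  have H: "x \<in> H \<Longrightarrow> x \<in> carrier L" for x using assms unfolding submodule_iff by auto
  show ?thesis
    using assms unfolding submodule_iff Q.submodule_iff
    by (auto simp: carrier_Q add_Q smult_Q zero_Q H simp del: a_coset_add_zero)
qed

text \<open>A subspace containing \<open>I\<close> is a union of cosets, hence is recovered from its
  image.\<close>

lemma cls_mem_image:
  assumes "submodule H R L" "I \<subseteq> H" "x \<in> carrier L" "cls x \<in> cls ` H"
  shows "x \<in> H"
proof -
  obtain y where y: "y \<in> H" "cls x = cls y" using assms(4) by blast
  then have "x \<in> cls y" using cls_self[OF assms(3)] by simp
  then show ?thesis using assms(1,2) y(1) unfolding submodule_iff by (elim cls_memE) auto
qed

lemma submodule_vimage_cls:
  assumes "submodule H R L" "submodule K R Q"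
  shows "submodule {x \<in> H. cls x \<in> K} R L"
proof -
  interpret Q: lie_algebra R Q by (rule lie_algebra_Q)
  have "x \<in> H \<Longrightarrow> x \<in> carrier L" for x using assms(1) unfolding submodule_iff by auto
  then show ?thesis
    using assms unfolding submodule_iff Q.submodule_iff
    by (auto simp flip: add_Q smult_Q zero_Q simp del: a_coset_add_zero)
qed

text \<open>Correspondence of ideals: an ideal of the image of \<open>M\<close> is the image of its
  preimage \<open>K\<close>, which lies between \<open>I\<close> and \<open>M\<close>. Simplicity
  thus becomes a statement in \<open>L\<close> without cosets. Allowing a subalgebra
  \<open>M\<close> lets one lemma serve for the whole quotient and for its derived algebra.\<close>

lemma simple_quotient:
  assumes M: "submodule M R L" "I \<subseteq> M"
    and closed: "\<And>x y. x \<in> M \<Longrightarrow> y \<in> M \<Longrightarrow> bracket L x y \<in> M"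
    and nonabelian: "\<exists>x\<in>M. \<exists>y\<in>M. bracket L x y \<notin> I"
    and maximal: "\<And>K. submodule K R L \<Longrightarrow> I \<subseteq> K \<Longrightarrow> K \<subseteq> M \<Longrightarrow>
      (\<And>x y. x \<in> M \<Longrightarrow> y \<in> K \<Longrightarrow> bracket L x y \<in> K) \<Longrightarrow> K = I \<or> K = M"
  shows "simple_lie_algebra R (Q\<lparr>carrier := cls ` M\<rparr>)"
proof -
  let ?S = "Q\<lparr>carrier := cls ` M\<rparr>"
  interpret Q: lie_algebra R Q by (rule lie_algebra_Q)
  have M_carrier: "x \<in> M \<Longrightarrow> x \<in> carrier L" for x using M(1) unfolding submodule_iff by auto
  have lie: "lie_algebra R ?S"
    by (rule lie_subalgebra[OF lie_algebra_Q submodule_cls_image[OF M(1)]])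
      (auto simp: bracket_Q M_carrier closed)
  interpret S: lie_algebra R ?S by (rule lie)
  have "\<exists>x\<in>carrier ?S. \<exists>y\<in>carrier ?S. bracket ?S x y \<noteq> \<zero>\<^bsub>?S\<^esub>"
  proof -
    obtain x y where xy: "x \<in> M" "y \<in> M" "bracket L x y \<notin> I" using nonabelian by blast
    then have "bracket Q (cls x) (cls y) \<noteq> \<zero>\<^bsub>Q\<^esub>"
      by (simp add: bracket_Q M_carrier zero_Q cls_zero cls_eq_I_iff bracket_closed
          del: a_coset_add_zero)
    then show ?thesis using xy by auto
  qed
  moreover have "J = {\<zero>\<^bsub>?S\<^esub>} \<or> J = carrier ?S" if J: "lie_ideal J R ?S" for J
  proof -
    have J_subset: "J \<subseteq> cls ` M" and J_ideal: "x \<in> M \<Longrightarrow> y \<in> J \<Longrightarrow> bracket Q (cls x) y \<in> J" for x y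
      using J unfolding lie_ideal_def S.submodule_iff by auto
    have "cls ` M \<subseteq> carrier Q" using M_carrier by (auto simp: carrier_Q)
    then have J_sub: "submodule J R Q"
      using J unfolding lie_ideal_def S.submodule_iff Q.submodule_iff by auto
    define K where "K = {x \<in> M. cls x \<in> J}"
    have J_eq: "J = cls ` K" using J_subset by (auto simp: K_def)
    have "submodule K R L" unfolding K_def by (rule submodule_vimage_cls[OF M(1) J_sub])
    moreover have "I \<subseteq> K"
    proof
      fix h assume "h \<in> I"
      moreover from this have "cls h = \<zero>\<^bsub>Q\<^esub>"
        by (simp add: zero_Q cls_zero cls_eq_I_iff I_closed del: a_coset_add_zero)
      moreover have "\<zero>\<^bsub>Q\<^esub> \<in> J" using J_sub unfolding Q.submodule_iff by blast
      ultimately show "h \<in> K" using M(2) by (auto simp: K_def)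
    qed
    moreover have "bracket L x y \<in> K" if "x \<in> M" "y \<in> K" for x y
      using that J_ideal[of x "cls y"] by (simp add: K_def closed bracket_Q M_carrier)
    ultimately have "K = I \<or> K = M" by (intro maximal) (auto simp: K_def)
    then show ?thesis
    proof
      assume "K = I"
      moreover have "cls ` I = {I}"
      proof -
        have "cls h = I" if "h \<in> I" for h using cls_eq_I_iff I_closed(1) that by blast
        then have "cls ` I \<subseteq> {I}" by blast
        then show ?thesis using I_closed(2) by (metis image_is_empty empty_iff subset_singletonD)
      qed
      ultimately show ?thesis by (simp add: J_eq zero_Q cls_zero del: a_coset_add_zero)
    qed (simp add: J_eq)
  qed
  ultimately show ?thesis using lie by (simp add: simple_lie_algebra_def)
qed

end

lemma field_field_of: "field (field_of TYPE('k::field))"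
proof -
  have "\<exists>y. x * y = 1" if "x \<noteq> 0" for x :: 'k
    using that by (intro exI[of _ "inverse x"]) simp
  moreover have "\<exists>y. y + x = 0" for x :: 'k by (intro exI[of _ "- x"]) simp
  ultimately have "cring (field_of TYPE('k))"
    by (intro cringI abelian_groupI comm_monoidI) (auto simp: field_of_def algebra_simps)
  then interpret cring "field_of TYPE('k)" .
  show ?thesis
  proof (rule cring_fieldI)
    have "x \<in> Units (field_of TYPE('k))" if "x \<noteq> 0" for x
      using that by (auto simp: Units_def field_of_def intro!: exI[of _ "inverse x"])
    moreover have "0 \<notin> Units (field_of TYPE('k))" by (auto simp: Units_def field_of_def)
    ultimately show "Units (field_of TYPE('k)) = carrier (field_of TYPE('k)) - {\<zero>\<^bsub>field_of TYPE('k)\<^esub>}"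
      by (auto simp: field_of_def)
  qed
qed

abbreviation (input) lookup where "lookup \<equiv> Poly_Mapping.lookup"
abbreviation (input) keys where "keys \<equiv> Poly_Mapping.keys"
abbreviation (input) single where "single \<equiv> Poly_Mapping.single"

section \<open>Linear extension of maps on monomials\<close>

text \<open>An element is the finite sum of its monomials, all with exponents in \<open>S\<close>,
  so additive statements reduce to monomials.\<close>

lemma poly_mapping_keys_induct [consumes 1, case_names zero add single]:
  fixes u :: "'a \<Rightarrow>\<^sub>0 'b::comm_monoid_add"
  assumes "keys u \<subseteq> S" "P 0" "\<And>u v. P u \<Longrightarrow> P v \<Longrightarrow> P (u + v)"
    "\<And>k c. k \<in> S \<Longrightarrow> P (single k c)"
  shows "P u"
proof -
  have "P (\<Sum>k\<in>T. single k (lookup u k))" if "finite T" "T \<subseteq> S" for T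
    using that by (induction T rule: finite_induct) (use assms in auto)
  moreover have "u = (\<Sum>k\<in>keys u. single k (lookup u k))"
  proof (rule poly_mapping_eqI)
    fix k
    have "lookup (\<Sum>k\<in>keys u. single k (lookup u k)) k = (\<Sum>l\<in>keys u. if l = k then lookup u l else 0)"
      unfolding lookup_sum by (intro sum.cong) (auto simp: lookup_single)
    then show "lookup u k = lookup (\<Sum>k\<in>keys u. single k (lookup u k)) k"
      by (simp add: in_keys_iff)
  qed
  ultimately show ?thesis using assms(1) by (metis finite_keys)
qed

lemma poly_mapping_monomial_induct [case_names zero add single]:
  fixes u :: "'a \<Rightarrow>\<^sub>0 'b::comm_monoid_add"
  assumes "P 0" "\<And>u v. P u \<Longrightarrow> P v \<Longrightarrow> P (u + v)" "\<And>k c. P (single k c)"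
  shows "P u"
  by (rule poly_mapping_keys_induct[of u UNIV P]) (use assms in auto)

lemma lookup_scale [simp]: "lookup (scale c u) k = c * lookup u k"
  unfolding scale_def by (simp add: Poly_Mapping.map.rep_eq when_def)

interpretation scale: vector_space "scale :: 'k \<Rightarrow> ('a \<Rightarrow>\<^sub>0 'k) \<Rightarrow> 'a \<Rightarrow>\<^sub>0 'k::field"
  by unfold_locales (auto intro!: poly_mapping_eqI simp: lookup_add algebra_simps)

lemma scale_single [simp]: "scale c (single k d) = single k (c * d)"
  by (rule poly_mapping_eqI) (simp add: lookup_single when_def)

lemma scale_mult_left [simp]:
  "scale c u * v = scale c (u * (v :: 'a::comm_monoid_add \<Rightarrow>\<^sub>0 'k::field))"
  by (simp add: scale_def mult_map_scale_conv_mult mult.assoc)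

lemma scale_mult_right [simp]:
  "u * scale c v = scale c (u * (v :: 'a::comm_monoid_add \<Rightarrow>\<^sub>0 'k::field))"
  by (metis mult.commute scale_mult_left)

lemma keys_scale_subset: "keys (scale c u) \<subseteq> keys u"
  by (auto simp: in_keys_iff)

text \<open>The spaces \<open>A\<close>, \<open>M\<close> and \<open>Z\<close> below are all cut out
  by a condition on supports.\<close>

lemma subspace_keys: "scale.subspace {u. keys u \<subseteq> S}"
  by (auto simp: scale.subspace_def dest: keys_scale_subset[THEN subsetD] Poly_Mapping.keys_add[THEN subsetD])

text \<open>Summing over a common finite set turns additivity of \<open>lin_ext\<close> into a
  termwise identity, although the supports differ.\<close>

lemma lin_ext_superset:
  assumes "finite S" "keys u \<subseteq> S"
  shows "lin_ext f u = (\<Sum>b\<in>S. scale (lookup u b) (f b))"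
  unfolding lin_ext_def
  by (rule sum.mono_neutral_left) (use assms in \<open>auto simp: in_keys_iff\<close>)

lemma lin_ext_add: "lin_ext f (u + v) = lin_ext f u + lin_ext f v"
proof -
  let ?S = "keys u \<union> keys v"
  have "keys (u + v) \<subseteq> ?S" by (rule Poly_Mapping.keys_add)
  then show ?thesis
    by (simp add: lin_ext_superset[of ?S] lookup_add scale.scale_left_distrib sum.distrib)
qed

lemma lin_ext_scale: "lin_ext f (scale c u) = scale c (lin_ext f u)"
  by (simp add: lin_ext_superset[of "keys u"] keys_scale_subset scale.scale_sum_right)

lemma lin_ext_single: "lin_ext f (single k c) = scale c (f k)"
  by (cases "c = 0") (auto simp: lin_ext_def)

section \<open>The derivations\<close>

lemma d1_add: "d1 \<phi> (u + v) = d1 \<phi> u + d1 \<phi> v"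
  and d2_add: "d2 \<phi> (u + v) = d2 \<phi> u + d2 \<phi> v"
  and d1_scale: "d1 \<phi> (scale c u) = scale c (d1 \<phi> u)"
  and d2_scale: "d2 \<phi> (scale c u) = scale c (d2 \<phi> u)"
  by (simp_all add: d1_def d2_def lin_ext_add lin_ext_scale)

lemma d1_single: "d1 \<phi> (single (\<alpha>, i, j) c) =
    single (\<alpha>, i, j) (\<phi> \<alpha> * c) + single (\<alpha>, i - 1, j) (of_nat i * c)"
  and d2_single: "d2 \<phi> (single (\<alpha>, i, j) c) =
    single (\<alpha>, i, j) (\<phi> \<alpha> * c) + single (\<alpha>, i, j - 1) (of_nat j * c)"
  by (simp_all add: d1_def d2_def lin_ext_single xmon_def scale.scale_right_distrib mult.commute)

lemma d1_zero [simp]: "d1 \<phi> 0 = 0" and d2_zero [simp]: "d2 \<phi> 0 = 0"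
  by (simp_all add: d1_def d2_def lin_ext_def)

lemma d1_uminus: "d1 \<phi> (- u) = - d1 \<phi> u" and d2_uminus: "d2 \<phi> (- u) = - d2 \<phi> u"
  using d1_add[of \<phi> u "- u"] d2_add[of \<phi> u "- u"] by (simp_all add: eq_neg_iff_add_eq_0 add.commute)

lemma d1_diff: "d1 \<phi> (u - v) = d1 \<phi> u - d1 \<phi> v"
  and d2_diff: "d2 \<phi> (u - v) = d2 \<phi> u - d2 \<phi> v"
  using d1_add[of \<phi> u "- v"] d2_add[of \<phi> u "- v"] by (simp_all add: d1_uminus d2_uminus)

text \<open>Comparing coefficients turns an eigenvalue equation for \<open>d1\<close> into a
  recursion in the exponent \<open>i\<close>.\<close>

lemma lookup_d1: "lookup (d1 \<phi> u) (\<alpha>, i, j) =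
    \<phi> \<alpha> * lookup u (\<alpha>, i, j) + of_nat (Suc i) * lookup u (\<alpha>, Suc i, j)"
proof (induction u rule: poly_mapping_monomial_induct)
  case (single k c)
  then show ?case
    by (cases k; cases "fst (snd k)") (auto simp: d1_single lookup_add lookup_single when_def)
qed (auto simp: d1_add lookup_add algebra_simps)

lemma lookup_d2: "lookup (d2 \<phi> u) (\<alpha>, i, j) =
    \<phi> \<alpha> * lookup u (\<alpha>, i, j) + of_nat (Suc j) * lookup u (\<alpha>, i, Suc j)"
proof (induction u rule: poly_mapping_monomial_induct)
  case (single k c)
  then show ?case
    by (cases k; cases "snd (snd k)") (auto simp: d2_single lookup_add lookup_single when_def)
qed (auto simp: d2_add lookup_add algebra_simps)

lemma d1_d2_commute: "d1 \<phi> (d2 \<psi> u) = d2 \<psi> (d1 \<phi> u)"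
  by (rule poly_mapping_eqI) (auto simp: lookup_d1 lookup_d2 algebra_simps)

text \<open>Both sides are bilinear, so monomials suffice. The case split on \<open>i\<close> and
  \<open>m\<close> settles the truncated \<open>i - 1\<close> and \<open>m - 1\<close>, which occur
  with coefficient 0.\<close>

lemma d1_mult:
  assumes "Modules.additive \<phi>"
  shows "d1 \<phi> (u * v) = d1 \<phi> u * v + u * d1 \<phi> v"
proof (induction u rule: poly_mapping_monomial_induct)
  case (single k c)
  show ?case
  proof (induction v rule: poly_mapping_monomial_induct)
    case (single l d)
    obtain \<alpha> i j where k: "k = (\<alpha>, i, j)" by (cases k)
    obtain \<beta> m n where l: "l = (\<beta>, m, n)" by (cases l)
    show ?case
      using additive.add[OF assms, of \<alpha> \<beta>] unfolding k l
      by (cases i; cases m) (simp_all add: d1_single mult_single distrib_left distrib_right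
          algebra_simps flip: single_add)
  qed (simp_all add: d1_add algebra_simps)
qed (simp_all add: d1_add algebra_simps)

lemma d2_mult:
  assumes "Modules.additive \<phi>"
  shows "d2 \<phi> (u * v) = d2 \<phi> u * v + u * d2 \<phi> v"
proof (induction u rule: poly_mapping_monomial_induct)
  case (single k c)
  show ?case
  proof (induction v rule: poly_mapping_monomial_induct)
    case (single l d)
    obtain \<alpha> i j where k: "k = (\<alpha>, i, j)" by (cases k)
    obtain \<beta> m n where l: "l = (\<beta>, m, n)" by (cases l)
    show ?case
      using additive.add[OF assms, of \<alpha> \<beta>] unfolding k l
      by (cases j; cases n) (simp_all add: d2_single mult_single distrib_left distrib_right
          algebra_simps flip: single_add)
  qed (simp_all add: d2_add algebra_simps)
qed (simp_all add: d2_add algebra_simps)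

section \<open>Eigenvectors of the derivations, and local annihilation by split polynomials\<close>

text \<open>At the largest exponent \<open>m\<close> occurring with \<alpha> and \<open>j\<close>,
  the term from \<open>Suc m\<close> vanishes, which forces the eigenvalue. The recursion then says
  that \<open>of_nat (Suc i)\<close> kills every coefficient with exponent \<open>Suc i\<close>, and
  characteristic 0 leaves only \<open>i = 0\<close>.\<close>

lemma d1_eigenvector_keys:
  fixes \<phi> :: "'g \<Rightarrow> 'k::field_char_0"
  assumes "d1 \<phi> u = scale a u" "(\<alpha>, i, j) \<in> keys u"
  shows "\<phi> \<alpha> = a" "i = 0"
proof -
  have rec: "of_nat (Suc i) * lookup u (\<beta>, Suc i, j) = (a - \<phi> \<beta>) * lookup u (\<beta>, i, j)" for \<beta> i j
    using lookup_d1[of \<phi> u \<beta> i j] assms(1) by (simp add: algebra_simps)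
  have fin: "finite {i. (\<alpha>, i, j) \<in> keys u}"
    by (rule finite_subset[of _ "(fst \<circ> snd) ` keys u"]) (force intro: image_eqI)+
  define m where "m = Max {i. (\<alpha>, i, j) \<in> keys u}"
  have "m \<in> {i. (\<alpha>, i, j) \<in> keys u}"
    unfolding m_def by (rule Max_in[OF fin]) (use assms in auto)
  moreover have "(\<alpha>, Suc m, j) \<notin> keys u"
    using Max_ge[OF fin, of "Suc m"] by (auto simp flip: m_def)
  ultimately show *: "\<phi> \<alpha> = a"
    using rec[of m \<alpha> j] by (auto simp: in_keys_iff)
  show "i = 0"
    using rec[of "i - 1" \<alpha> j] assms(2) by (cases i) (auto simp: * in_keys_iff simp del: of_nat_Suc)
qed

lemma d2_eigenvector_keys:
  fixes \<phi> :: "'g \<Rightarrow> 'k::field_char_0"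
  assumes "d2 \<phi> u = scale a u" "(\<alpha>, i, j) \<in> keys u"
  shows "\<phi> \<alpha> = a" "j = 0"
proof -
  have rec: "of_nat (Suc j) * lookup u (\<beta>, i, Suc j) = (a - \<phi> \<beta>) * lookup u (\<beta>, i, j)" for \<beta> i j
    using lookup_d2[of \<phi> u \<beta> i j] assms(1) by (simp add: algebra_simps)
  have fin: "finite {j. (\<alpha>, i, j) \<in> keys u}"
    by (rule finite_subset[of _ "(snd \<circ> snd) ` keys u"]) (force intro: image_eqI)+
  define m where "m = Max {j. (\<alpha>, i, j) \<in> keys u}"
  have "m \<in> {j. (\<alpha>, i, j) \<in> keys u}"
    unfolding m_def by (rule Max_in[OF fin]) (use assms in auto)
  moreover have "(\<alpha>, i, Suc m) \<notin> keys u"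
    using Max_ge[OF fin, of "Suc m"] by (auto simp flip: m_def)
  ultimately show *: "\<phi> \<alpha> = a"
    using rec[of m \<alpha> i] by (auto simp: in_keys_iff)
  show "j = 0"
    using rec[of "j - 1" \<alpha> i] assms(2) by (cases j) (auto simp: * in_keys_iff simp del: of_nat_Suc)
qed

text \<open>The vectors annihilated by some product of operators \<open>T - a\<close>.\<close>

inductive_set split_annihilated ::
    "(('a \<Rightarrow>\<^sub>0 'k) \<Rightarrow> 'a \<Rightarrow>\<^sub>0 'k) \<Rightarrow> ('a \<Rightarrow>\<^sub>0 'k::field) set" for T where
  zero: "0 \<in> split_annihilated T"
| step: "T u - scale a u \<in> split_annihilated T \<Longrightarrow> u \<in> split_annihilated T"

lemma split_annihilated_add:
  assumes lin: "\<And>u v. T (u + v) = T u + T v" "\<And>c u. T (scale c u) = scale c (T u)"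
    and "u \<in> split_annihilated T" "v \<in> split_annihilated T"
  shows "u + v \<in> split_annihilated T"
proof -
  have diff: "T (u - v) = T u - T v" for u v
    using lin(1)[of "u - v" v] by simp
  \<comment> \<open>The factors \<open>T - a\<close> and \<open>T - b\<close> commute, so the set is
    stable under every \<open>T - b\<close>; each factor chosen for \<open>u\<close> can then be
    applied to \<open>v\<close> as well.\<close>
  have closed: "T u - scale b u \<in> split_annihilated T" if "u \<in> split_annihilated T" for u b
    using that
  proof (induction u rule: split_annihilated.induct)
    case zero
    show ?case using diff[of 0 0] by (simp add: split_annihilated.zero)
  next
    case (step u a)
    have "T (T u - scale b u) - scale a (T u - scale b u) =
        T (T u - scale a u) - scale b (T u - scale a u)"
      by (simp add: diff lin(2) scale.scale_right_diff_distrib mult.commute)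
    then show ?case using step.IH by (metis split_annihilated.step)
  qed
  show ?thesis using assms(3,4)
  proof (induction u arbitrary: v rule: split_annihilated.induct)
    case (step u a)
    have "T (u + v) - scale a (u + v) = (T u - scale a u) + (T v - scale a v)"
      by (simp add: lin(1) scale.scale_right_distrib)
    then show ?case using step.IH[OF closed[OF step.prems]] by (metis split_annihilated.step)
  qed simp
qed

text \<open>On a monomial, subtracting the weight from \<open>d1\<close> leaves the operator that
  lowers \<open>i\<close>, so \<open>i + 1\<close> applications give 0.\<close>

lemma split_annihilated_d1: "u \<in> split_annihilated (d1 \<phi>)"
proof (induction u rule: poly_mapping_monomial_induct)
  case (single k c)
  obtain \<alpha> i j where k: "k = (\<alpha>, i, j)" by (cases k)
  have "single (\<alpha>, i, j) c \<in> split_annihilated (d1 \<phi>)" for c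
  proof (induction i arbitrary: c)
    case 0
    have "d1 \<phi> (single (\<alpha>, 0, j) c) - scale (\<phi> \<alpha>) (single (\<alpha>, 0, j) c) = 0"
      by (simp add: d1_single)
    then show ?case by (metis split_annihilated.intros)
  next
    case (Suc i)
    have "d1 \<phi> (single (\<alpha>, Suc i, j) c) - scale (\<phi> \<alpha>) (single (\<alpha>, Suc i, j) c) =
        single (\<alpha>, i, j) (of_nat (Suc i) * c)"
      by (simp add: d1_single)
    then show ?case using Suc.IH by (metis split_annihilated.step)
  qed
  then show ?case by (simp add: k)
qed (auto intro: split_annihilated.zero split_annihilated_add simp: d1_add d1_scale)

lemma split_annihilated_d2: "u \<in> split_annihilated (d2 \<phi>)"
proof (induction u rule: poly_mapping_monomial_induct)
  case (single k c)
  obtain \<alpha> i j where k: "k = (\<alpha>, i, j)" by (cases k)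
  have "single (\<alpha>, i, j) c \<in> split_annihilated (d2 \<phi>)" for c
  proof (induction j arbitrary: c)
    case 0
    have "d2 \<phi> (single (\<alpha>, i, 0) c) - scale (\<phi> \<alpha>) (single (\<alpha>, i, 0) c) = 0"
      by (simp add: d2_single)
    then show ?case by (metis split_annihilated.intros)
  next
    case (Suc j)
    have "d2 \<phi> (single (\<alpha>, i, Suc j) c) - scale (\<phi> \<alpha>) (single (\<alpha>, i, Suc j) c) =
        single (\<alpha>, i, j) (of_nat (Suc j) * c)"
      by (simp add: d2_single)
    then show ?case using Suc.IH by (metis split_annihilated.step)
  qed
  then show ?case by (simp add: k)
qed (auto intro: split_annihilated.zero split_annihilated_add simp: d2_add d2_scale)

section \<open>The Lie algebra and its ideals\<close>

locale block_algebra =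
  fixes \<phi>1 \<phi>2 :: "'g::ab_group_add \<Rightarrow> 'k::field_char_0"
    and J1 J2 :: "nat set"
  assumes J1: "J1 \<in> {{0}, UNIV}"
    and J2: "J2 \<in> {{0}, UNIV}"
    and hom1: "Modules.additive \<phi>1"
    and hom2: "Modules.additive \<phi>2"
    and nonzero1: "J1 = {0} \<Longrightarrow> \<phi>1 \<noteq> (\<lambda>_. 0)"
    and kernels: "{\<gamma>. \<phi>1 \<gamma> = 0} \<inter> {\<gamma>. \<phi>2 \<gamma> = 0} = {0}"
begin

abbreviation "D1 \<equiv> d1 \<phi>1"
abbreviation "D2 \<equiv> d2 \<phi>2"
abbreviation "br \<equiv> bracket1 \<phi>1 \<phi>2"

definition A where "A = {u :: 'g \<times> nat \<times> nat \<Rightarrow>\<^sub>0 'k. keys u \<subseteq> UNIV \<times> J1 \<times> J2}"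

text \<open>In case (b) the monomial \<open>x\<^bsup>\<sigma>\<^sub>2\<^esup>\<close> does not occur in any bracket; with this exponent removed, both
  cases of the theorem ask for simplicity of \<open>M\<close> modulo the central line \<open>Z\<close>.\<close>

definition good where
  "good = {(\<alpha>, i, j). i \<in> J1 \<and> j \<in> J2 \<and> \<not> (J1 = {0} \<and> J2 = {0} \<and> \<phi>1 \<alpha> = 0 \<and> \<phi>2 \<alpha> = 2)}"

definition M where "M = {u :: 'g \<times> nat \<times> nat \<Rightarrow>\<^sub>0 'k. keys u \<subseteq> good}"

text \<open>Described by supports, so that a missing \<open>\<sigma>\<^sub>1\<close> gives the zero
  space without a case distinction.\<close>

definition Z where
  "Z = {u :: 'g \<times> nat \<times> nat \<Rightarrow>\<^sub>0 'k. keys u \<subseteq> {(\<sigma>, 0, 0) | \<sigma>. is_sigma \<phi>1 \<phi>2 1 \<sigma>}}"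

section \<open>Identities of the bracket\<close>

lemma additive_simps [simp]:
  "\<phi>1 0 = 0" "\<phi>2 0 = 0" "\<phi>1 (\<alpha> + \<beta>) = \<phi>1 \<alpha> + \<phi>1 \<beta>" "\<phi>2 (\<alpha> + \<beta>) = \<phi>2 \<alpha> + \<phi>2 \<beta>"
  "\<phi>1 (- \<alpha>) = - \<phi>1 \<alpha>" "\<phi>2 (- \<alpha>) = - \<phi>2 \<alpha>"
  using hom1 hom2 by (simp_all add: additive.zero additive.add additive.minus)

lemma kernelsD: "\<phi>1 \<alpha> = \<phi>1 \<beta> \<Longrightarrow> \<phi>2 \<alpha> = \<phi>2 \<beta> \<Longrightarrow> \<alpha> = \<beta>"
  using kernels[THEN eqset_imp_iff, of "\<alpha> - \<beta>"] additive.diff[OF hom1, of \<alpha> \<beta>]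
    additive.diff[OF hom2, of \<alpha> \<beta>] by simp

lemmas d1_linear = d1_add d1_diff d1_uminus d1_scale
lemmas d2_linear = d2_add d2_diff d2_uminus d2_scale
lemmas derivation = d1_mult[OF hom1] d2_mult[OF hom2] d1_d2_commute

lemma one_eq_single: "(1 :: 'g \<times> nat \<times> nat \<Rightarrow>\<^sub>0 'k) = single (0, 0, 0) 1"
  by (simp flip: single_one add: zero_prod_def)

lemma d_one [simp]: "D1 1 = 0" "D2 1 = 0"
  by (simp_all add: one_eq_single d1_single d2_single)

lemma br_eq: "br u v = D1 u * (D2 v - v) - D1 v * (D2 u - u)"
  by (simp add: bracket1_def algebra_simps)

lemma br_add_left: "br (u + v) w = br u w + br v w"
  and br_add_right: "br w (u + v) = br w u + br w v"
  and br_scale_left: "br (scale c u) w = scale c (br u w)"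
  and br_scale_right: "br w (scale c u) = scale c (br w u)"
  and br_self: "br u u = 0"
  by (simp_all add: br_eq d1_linear d2_linear algebra_simps scale.scale_right_diff_distrib
      scale.scale_right_distrib)

text \<open>The operator \<open>E\<close>, which is \<open>D2\<close> minus the identity, commutes
  with \<open>D1\<close> and satisfies the Leibniz rule up to an extra \<open>x * y\<close>. With
  these rules the cyclic sum expands into terms that cancel in a commutative ring.\<close>

lemma br_jacobi: "br u (br v w) + br v (br w u) + br w (br u v) = 0"
proof -
  define E where "E x = D2 x - x" for x
  have E: "E (x - y) = E x - E y" "E (x * y) = E x * y + x * E y + x * y" "D1 (E x) = E (D1 x)" for x y
    by (simp_all add: E_def d1_linear d2_linear derivation algebra_simps)
  have br: "br x y = D1 x * E y - D1 y * E x" for x y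
    by (simp add: br_eq E_def)
  show ?thesis
    unfolding br d1_diff derivation(1) E by (simp add: algebra_simps)
qed

lemma br_one_left: "br 1 u = D1 u"
  by (simp add: br_eq)

text \<open>As \<open>D1\<close> is the bracket with 1, this is an instance of the Jacobi identity.
  Hence \<open>D1\<close>-weights add under the bracket.\<close>

lemma d1_br: "D1 (br u v) = br (D1 u) v + br u (D1 v)"
  unfolding br_eq by (simp add: d1_linear d2_linear derivation algebra_simps)

section \<open>The subspaces \<open>A\<close>, \<open>M\<close>, \<open>Z\<close> and their closure
  properties\<close>

lemma subspace_A: "scale.subspace A" and subspace_M: "scale.subspace M"
  and subspace_Z: "scale.subspace Z"
  unfolding A_def M_def Z_def by (rule subspace_keys)+

lemma good_subset: "good \<subseteq> UNIV \<times> J1 \<times> J2"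
  by (auto simp: good_def)

lemma M_subset_A: "M \<subseteq> A"
  using good_subset by (auto simp: M_def A_def)

lemma zero_in_J: "0 \<in> J1" "0 \<in> J2"
  using J1 J2 by auto

lemma Z_subset_M: "Z \<subseteq> M"
proof -
  have "{(\<sigma>, 0, 0) | \<sigma>. is_sigma \<phi>1 \<phi>2 1 \<sigma>} \<subseteq> good"
    using zero_in_J by (auto simp: good_def is_sigma_def)
  then show ?thesis by (auto simp: Z_def M_def)
qed

lemma single_in_A: "i \<in> J1 \<Longrightarrow> j \<in> J2 \<Longrightarrow> single (\<alpha>, i, j) c \<in> A"
  by (auto simp: A_def)

lemma single_in_M: "(\<alpha>, i, j) \<in> good \<Longrightarrow> single (\<alpha>, i, j) c \<in> M"
  by (auto simp: M_def)

lemma Suc_in_J: "Suc i \<in> J1 \<Longrightarrow> i \<in> J1" "Suc j \<in> J2 \<Longrightarrow> j \<in> J2"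
  using J1 J2 by auto

lemma d1_in_A: assumes "u \<in> A" shows "D1 u \<in> A"
proof -
  have "i \<in> J1 \<and> j \<in> J2" if "(\<alpha>, i, j) \<in> keys (D1 u)" for \<alpha> i j
  proof -
    have "(\<alpha>, i, j) \<in> keys u \<or> (\<alpha>, Suc i, j) \<in> keys u"
      using that by (auto simp: in_keys_iff lookup_d1)
    then show ?thesis using assms Suc_in_J by (auto simp: A_def)
  qed
  then show ?thesis by (auto simp: A_def)
qed

lemma d2_in_A: assumes "u \<in> A" shows "D2 u \<in> A"
proof -
  have "i \<in> J1 \<and> j \<in> J2" if "(\<alpha>, i, j) \<in> keys (D2 u)" for \<alpha> i j
  proof -
    have "(\<alpha>, i, j) \<in> keys u \<or> (\<alpha>, i, Suc j) \<in> keys u"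
      using that by (auto simp: in_keys_iff lookup_d2)
    then show ?thesis using assms Suc_in_J by (auto simp: A_def)
  qed
  then show ?thesis by (auto simp: A_def)
qed

lemma add_in_J: "i \<in> J1 \<Longrightarrow> m \<in> J1 \<Longrightarrow> i + m \<in> J1" "j \<in> J2 \<Longrightarrow> n \<in> J2 \<Longrightarrow> j + n \<in> J2"
  using J1 J2 by auto

lemma mult_in_A: assumes "u \<in> A" "v \<in> A" shows "u * v \<in> A"
proof -
  have "{a + b | a b. a \<in> keys u \<and> b \<in> keys v} \<subseteq> UNIV \<times> J1 \<times> J2"
    using assms add_in_J by (auto simp: A_def subset_iff)
  then show ?thesis using keys_mult[of u v] unfolding A_def by blast
qed

lemma br_in_A: "u \<in> A \<Longrightarrow> v \<in> A \<Longrightarrow> br u v \<in> A"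
  unfolding br_eq by (intro scale.subspace_diff[OF subspace_A] mult_in_A d1_in_A d2_in_A)

text \<open>Only the case without polynomial variables needs work. There two monomials whose
  exponents add up to \<open>\<sigma>\<^sub>2\<close> have opposite first weights and second weights
  with sum 2, and the coefficient of their bracket cancels.\<close>

lemma br_in_M: assumes "u \<in> A" "v \<in> A" shows "br u v \<in> M"
proof (cases "J1 = {0} \<and> J2 = {0}")
  case False
  then have "good = UNIV \<times> J1 \<times> J2" by (auto simp: good_def)
  then show ?thesis using br_in_A[OF assms] by (simp add: A_def M_def)
next
  case True
  have "keys u \<subseteq> UNIV \<times> J1 \<times> J2" "keys v \<subseteq> UNIV \<times> J1 \<times> J2"
    using assms by (auto simp: A_def)
  then show ?thesis
  proof (induction u rule: poly_mapping_keys_induct)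
    case (single k c)
    note k = single.hyps single.prems
    show ?case using k(2)
    proof (induction v rule: poly_mapping_keys_induct)
      case (single l d)
      obtain \<alpha> \<beta> where kl: "k = (\<alpha>, 0, 0)" "l = (\<beta>, 0, 0)"
        using k(1) single.hyps True by (cases k; cases l) auto
      have br: "br (single k c) (single l d) =
          single (\<alpha> + \<beta>, 0, 0) (c * d * (\<phi>1 \<alpha> * (\<phi>2 \<beta> - 1) - \<phi>1 \<beta> * (\<phi>2 \<alpha> - 1)))"
        by (simp add: br_eq kl d1_single d2_single mult_single add.commute[of \<beta>] flip: single_diff)
          (simp add: algebra_simps)
      show ?case
      proof (cases "(\<alpha> + \<beta>, 0, 0) \<in> good")
        case True
        then show ?thesis unfolding br by (rule single_in_M)
      next
        case False
        then have sum: "\<phi>1 \<alpha> + \<phi>1 \<beta> = 0" "\<phi>2 \<alpha> + \<phi>2 \<beta> = 2"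
          using True unfolding good_def by simp_all
        have "\<phi>1 \<beta> = - \<phi>1 \<alpha>" "\<phi>2 \<beta> = 2 - \<phi>2 \<alpha>"
          using sum by (metis add.commute eq_neg_iff_add_eq_0) (use sum in \<open>metis add_diff_cancel_left'\<close>)
        then have "\<phi>1 \<alpha> * (\<phi>2 \<beta> - 1) - \<phi>1 \<beta> * (\<phi>2 \<alpha> - 1) =
            \<phi>1 \<alpha> * (2 - \<phi>2 \<alpha> - 1) - (- \<phi>1 \<alpha>) * (\<phi>2 \<alpha> - 1)"
          by (simp only:)
        also have "\<dots> = 0" by (simp add: algebra_simps)
        finally have "\<phi>1 \<alpha> * (\<phi>2 \<beta> - 1) - \<phi>1 \<beta> * (\<phi>2 \<alpha> - 1) = 0" .
        then show ?thesis unfolding br by (simp add: scale.subspace_0[OF subspace_M])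
      qed
    qed (auto simp: br_add_right br_eq[of _ 0] intro: scale.subspace_add[OF subspace_M] scale.subspace_0[OF subspace_M])
  qed (auto simp: br_add_left br_eq[of 0] intro: scale.subspace_add[OF subspace_M] scale.subspace_0[OF subspace_M])
qed

text \<open>Joint eigenvectors of \<open>D1\<close> and \<open>D2\<close> have no polynomial part,
  so the weights 0 and 1 single out \<open>\<sigma>\<^sub>1\<close>. For a
  \<open>D1\<close>-constant \<open>f\<close> in \<open>A\<close>, being outside \<open>Z\<close>
  thus means that \<open>D2 f - f\<close> is nonzero.\<close>

lemma Z_iff: "u \<in> Z \<longleftrightarrow> u \<in> A \<and> D1 u = 0 \<and> D2 u = u"
proof
  assume "u \<in> Z"
  moreover have "D1 u = 0 \<and> D2 u = u"
    using \<open>u \<in> Z\<close> unfolding Z_def mem_Collect_eq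
    by (induction u rule: poly_mapping_keys_induct)
      (auto simp: d1_linear d2_linear is_sigma_def d1_single d2_single)
  ultimately show "u \<in> A \<and> D1 u = 0 \<and> D2 u = u"
    using Z_subset_M M_subset_A by blast
next
  assume *: "u \<in> A \<and> D1 u = 0 \<and> D2 u = u"
  then have d: "D1 u = scale 0 u" "D2 u = scale 1 u"
    using scale.scale_zero_left[of u] scale.scale_one[of u] by metis+
  have "k \<in> {(\<sigma>, 0, 0) | \<sigma>. is_sigma \<phi>1 \<phi>2 1 \<sigma>}" if "k \<in> keys u" for k
  proof -
    obtain \<alpha> i j where k: "k = (\<alpha>, i, j)" by (cases k)
    show ?thesis
      using d1_eigenvector_keys[OF d(1) that[unfolded k]] d2_eigenvector_keys[OF d(2) that[unfolded k]]
      by (simp add: k is_sigma_def)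
  qed
  then show "u \<in> Z" unfolding Z_def by blast
qed

lemma br_Z: "u \<in> Z \<Longrightarrow> br v u = 0"
  by (simp add: Z_iff br_eq)

lemma one_not_in_Z: "c \<noteq> 0 \<Longrightarrow> single (0, 0, 0) c \<notin> Z"
  by (auto simp: Z_def is_sigma_def)

lemma one_in_M: "1 \<in> M"
  using zero_in_J by (auto simp: one_eq_single M_def good_def)

section \<open>Preimages under \<open>D1\<close> and special brackets\<close>

lemma exists_nonzero_weight: "J1 = {0} \<Longrightarrow> \<exists>\<beta>. \<phi>1 \<beta> \<noteq> 0"
  using nonzero1 by auto

lemma good_if_nonzero_weight: "\<phi>1 \<alpha> \<noteq> 0 \<Longrightarrow> i \<in> J1 \<Longrightarrow> j \<in> J2 \<Longrightarrow> (\<alpha>, i, j) \<in> good"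
  by (simp add: good_def)

text \<open>Integration of monomials: for weight 0 the exponent \<open>i\<close> is raised; for
  nonzero weight one divides by the weight and corrects the lower term by induction on
  \<open>i\<close>.\<close>

lemma d1_surj_A:
  assumes "J1 = UNIV" "u \<in> A"
  shows "\<exists>v\<in>A. D1 v = u"
proof -
  have mono: "single (\<alpha>, i, j) c \<in> A" if "j \<in> J2" for \<alpha> i j c
    by (rule single_in_A) (simp_all add: assms(1) that)
  have "keys u \<subseteq> UNIV \<times> J1 \<times> J2" using assms(2) by (simp add: A_def)
  then show ?thesis
  proof (induction u rule: poly_mapping_keys_induct)
    case zero
    show ?case by (rule bexI[of _ 0]) (simp_all add: scale.subspace_0[OF subspace_A])
  next
    case (add u v)
    then obtain u' v' where "u' \<in> A" "D1 u' = u" "v' \<in> A" "D1 v' = v" by auto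
    then show ?case
      by (intro bexI[of _ "u' + v'"]) (simp_all add: d1_add scale.subspace_add[OF subspace_A])
  next
    case (single k c)
    obtain \<alpha> i j where k: "k = (\<alpha>, i, j)" by (cases k)
    have j: "j \<in> J2" using single by (simp add: k)
    have "\<exists>v\<in>A. D1 v = single (\<alpha>, i, j) c"
    proof (cases "\<phi>1 \<alpha> = 0")
      case True
      show ?thesis
        by (rule bexI[of _ "single (\<alpha>, Suc i, j) (c / of_nat (Suc i))"])
          (simp_all add: True d1_single mono j del: of_nat_Suc)
    next
      case False
      show ?thesis
      proof (induction i arbitrary: c)
        case 0
        show ?case
          by (rule bexI[of _ "single (\<alpha>, 0, j) (c / \<phi>1 \<alpha>)"]) (simp_all add: False d1_single mono j)
      next
        case (Suc i)
        obtain w where w: "w \<in> A" "D1 w = single (\<alpha>, i, j) (of_nat (Suc i) * (c / \<phi>1 \<alpha>))"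
          using Suc.IH by blast
        show ?case
          by (rule bexI[of _ "single (\<alpha>, Suc i, j) (c / \<phi>1 \<alpha>) - w"])
            (simp_all add: False d1_single d1_diff w(2) scale.subspace_diff[OF subspace_A w(1)]
              scale.subspace_diff[OF subspace_A _ w(1)] mono j del: of_nat_Suc)
      qed
    qed
    then show ?case by (simp add: k)
  qed
qed

lemma t1_in_M: "J1 = UNIV \<Longrightarrow> single (0, 1, 0) c \<in> M"
  using zero_in_J by (intro single_in_M) (unfold good_def, simp)

text \<open>As \<open>D1\<close> is the bracket with 1, this shows that brackets in \<open>M\<close>
  do not all lie in \<open>Z\<close>. A monomial of nonzero weight, or else the polynomial variable,
  is a witness.\<close>

lemma exists_d1_not_in_Z: "\<exists>v\<in>M. D1 v \<notin> Z"
proof (cases "J1 = {0}")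
  case True
  then obtain \<beta> where \<beta>: "\<phi>1 \<beta> \<noteq> 0" using exists_nonzero_weight by blast
  have "D1 (single (\<beta>, 0, 0) 1) \<notin> Z" "single (\<beta>, 0, 0) 1 \<in> M"
    using \<beta> zero_in_J by (auto simp: d1_single Z_def is_sigma_def intro: single_in_M good_if_nonzero_weight)
  then show ?thesis by blast
next
  case False
  then have "J1 = UNIV" using J1 by simp
  then have "single (0, 1, 0) 1 \<in> M" by (rule t1_in_M)
  moreover have "D1 (single (0, 1, 0) 1) \<notin> Z"
    by (simp add: d1_single one_not_in_Z)
  ultimately show ?thesis by blast
qed

text \<open>The weights factor out as -a, and the Leibniz rule for \<open>D2\<close> collects the
  rest. Such brackets are \<open>D1\<close>-constants, which makes these accessible when
  \<open>D1\<close> is not surjective.\<close>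

lemma br_opposite_weight:
  assumes "D1 u = scale a u" "D1 v = scale (- a) v"
  shows "br v u = scale (- a) (D2 (v * u) - scale 2 (v * u))"
proof -
  have two: "scale 2 (v * u) = v * u + v * u"
    using scale.scale_left_distrib[of 1 1 "v * u"] by simp
  have "br v u = scale (- a) (v * (D2 u - u) + u * (D2 v - v))"
    by (simp add: br_eq assms scale.scale_right_distrib)
  also have "v * (D2 u - u) + u * (D2 v - v) = D2 (v * u) - scale 2 (v * u)"
    unfolding two by (simp add: derivation algebra_simps)
  finally show ?thesis .
qed

text \<open>If \<open>J1\<close> is infinite, take \<open>v\<close> to be the polynomial variable, so that \<open>D1 v = 1\<close>. Otherwise
  \<open>x\<^bsup>\<beta>\<^esup> = x\<^bsup>2\<beta>\<^esup> x\<^bsup>-\<beta>\<^esup>\<close>: the exponents \<open>2\<beta>\<close>, \<open>-\<beta>\<close> and their sum all have nonzero \<open>D1\<close>-weight.\<close>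

lemma d1_monomial_factor:
  assumes "i \<in> J1" "j \<in> J2"
  shows "\<exists>v\<in>M. \<exists>w\<in>A. \<exists>q\<in>A. D1 v * D1 w = D1 (single (\<beta>, i, j) c) \<and> br v (D1 w) = D1 q"
proof (cases "J1 = {0}")
  case False
  then have J: "J1 = UNIV" using J1 by simp
  define v w :: "'g \<times> nat \<times> nat \<Rightarrow>\<^sub>0 'k"
    where "v = single (0, 1, 0) 1" and "w = single (\<beta>, i, j) c"
  have "v \<in> M" unfolding v_def by (rule t1_in_M[OF J])
  have "w \<in> A" unfolding w_def using assms by (rule single_in_A)
  have "br v (D1 w) \<in> A"
    using \<open>v \<in> M\<close> \<open>w \<in> A\<close> M_subset_A by (intro br_in_A d1_in_A) auto
  then obtain q where "q \<in> A" "D1 q = br v (D1 w)" using d1_surj_A[OF J] by blast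
  moreover have "D1 v = 1" by (simp add: v_def d1_single one_eq_single)
  ultimately show ?thesis using \<open>v \<in> M\<close> \<open>w \<in> A\<close> unfolding w_def[symmetric] by (metis mult_1)
next
  case True
  then have i: "i = 0" using assms by simp
  show ?thesis
  proof (cases "\<phi>1 \<beta> = 0")
    case True
    then have "D1 (single (\<beta>, i, j) c) = 0" by (simp add: d1_single i)
    then show ?thesis
      using scale.subspace_0[OF subspace_M] scale.subspace_0[OF subspace_A]
      by (intro bexI[of _ 0]) (simp_all add: br_eq)
  next
    case False
    let ?b = "\<phi>1 \<beta>"
    \<comment> \<open>The weights 2b and -b contribute -2 b^2; the coefficient of \<open>w\<close>
      turns this into the factor b c of the target.\<close>
    define v w :: "'g \<times> nat \<times> nat \<Rightarrow>\<^sub>0 'k"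
      where "v = single (\<beta> + \<beta>, 0, 0) 1" and "w = single (- \<beta>, 0, j) (- (c / (2 * ?b)))"
    have "?b + ?b \<noteq> 0" using False by (simp flip: mult_2)
    then have "v \<in> M"
      unfolding v_def using zero_in_J by (intro single_in_M good_if_nonzero_weight) simp_all
    have "w \<in> A" unfolding w_def using assms zero_in_J by (intro single_in_A)
    have dv: "D1 v = scale (2 * ?b) v" and dw: "D1 w = scale (- ?b) w"
      by (simp_all add: v_def w_def d1_single)
    have "D1 v * D1 w = scale (- 2 * ?b * ?b) (v * w)"
      by (simp add: dv dw)
    also have "\<dots> = D1 (single (\<beta>, i, j) c)"
      using False by (simp add: v_def w_def mult_single d1_single i)
    finally have "D1 v * D1 w = D1 (single (\<beta>, i, j) c)" .
    \<comment> \<open>The weights add up to 2b - b = b, so \<open>q\<close> is the bracket divided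
      by b.\<close>
    moreover have "D1 (br v (D1 w)) = scale ?b (br v (D1 w))"
    proof -
      have "D1 (br v (D1 w)) = scale (2 * ?b) (br v (D1 w)) + scale (- ?b) (br v (D1 w))"
        unfolding d1_br by (simp only: dv dw d1_scale br_scale_left br_scale_right scale.scale_scale
            mult.commute)
      also have "\<dots> = scale (2 * ?b + - ?b) (br v (D1 w))"
        by (simp only: scale.scale_left_distrib)
      finally show ?thesis by simp
    qed
    then have "D1 (scale (1 / ?b) (br v (D1 w))) = br v (D1 w)"
      using False by (simp add: d1_scale)
    moreover have "scale (1 / ?b) (br v (D1 w)) \<in> A"
      using \<open>v \<in> M\<close> \<open>w \<in> A\<close> M_subset_A
      by (intro scale.subspace_scale[OF subspace_A] br_in_A d1_in_A) auto
    ultimately show ?thesis using \<open>v \<in> M\<close> \<open>w \<in> A\<close> by metis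
  qed
qed

text \<open>On exponents with second weight other than 2, the operator \<open>D2\<close> - 2 is
  triangular in \<open>j\<close> with nonzero diagonal and is inverted by induction. At weight 2 it
  is pure differentiation; goodness then forces \<open>J2 = UNIV\<close>, so that one can integrate
  from \<open>Suc j\<close>.\<close>

lemma d2_minus_2_monomial:
  assumes "J1 = {0}" "(\<gamma>, 0, j) \<in> good" "\<phi>1 \<gamma> = 0"
    and "scale.subspace S"
    and S: "\<And>u. u \<in> A \<Longrightarrow> D1 u = 0 \<Longrightarrow> D2 u - scale 2 u \<in> S"
  shows "single (\<gamma>, 0, j) c \<in> S"
proof (cases "\<phi>2 \<gamma> = 2")
  case True
  then have "J2 = UNIV" using assms(1-3) J2 unfolding good_def by simp
  then have "single (\<gamma>, 0, Suc j) (c / of_nat (Suc j)) \<in> A"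
    using zero_in_J by (intro single_in_A) simp_all
  from S[OF this] show ?thesis
    using True assms(3) by (simp add: d1_single d2_single del: of_nat_Suc)
next
  case False
  have "j \<in> J2" using assms(2) unfolding good_def by simp
  then show ?thesis
  proof (induction j arbitrary: c)
    case 0
    let ?c = "c / (\<phi>2 \<gamma> - 2)"
    have "single (\<gamma>, 0, 0) ?c \<in> A"
      using zero_in_J by (intro single_in_A)
    from S[OF this] have "single (\<gamma>, 0, 0) (\<phi>2 \<gamma> * ?c - 2 * ?c) \<in> S"
      using assms(3) by (simp add: d1_single d2_single single_diff)
    also have "\<phi>2 \<gamma> * ?c - 2 * ?c = c"
      using False unfolding left_diff_distrib[symmetric] by simp
    finally show ?case .
  next
    case (Suc j)
    let ?c = "c / (\<phi>2 \<gamma> - 2)"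
    have "single (\<gamma>, 0, Suc j) ?c \<in> A"
      using zero_in_J Suc.prems by (intro single_in_A)
    from S[OF this]
    have "D2 (single (\<gamma>, 0, Suc j) ?c) - scale 2 (single (\<gamma>, 0, Suc j) ?c) \<in> S"
      using assms(3) by (simp add: d1_single)
    also have "D2 (single (\<gamma>, 0, Suc j) ?c) - scale 2 (single (\<gamma>, 0, Suc j) ?c) =
        single (\<gamma>, 0, Suc j) (\<phi>2 \<gamma> * ?c - 2 * ?c) + single (\<gamma>, 0, j) (of_nat (Suc j) * ?c)"
      by (simp add: d2_single single_diff)
    also have "\<phi>2 \<gamma> * ?c - 2 * ?c = c"
      using False unfolding left_diff_distrib[symmetric] by simp
    finally have "single (\<gamma>, 0, Suc j) c + single (\<gamma>, 0, j) (of_nat (Suc j) * ?c) \<in> S" .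
    from scale.subspace_diff[OF assms(4) this Suc.IH[OF Suc_in_J(2)[OF Suc.prems], of "of_nat (Suc j) * ?c"]]
    show ?case by simp
  qed
qed

lemma lookup_shift: "lookup (single (- \<alpha>, 0, 0) 1 * u) (\<beta>, i, j) = lookup u (\<alpha> + \<beta>, i, j)"
  for u :: "'g \<times> nat \<times> nat \<Rightarrow>\<^sub>0 'k"
proof (induction u rule: poly_mapping_monomial_induct)
  case (single k c)
  have "- \<alpha> + \<gamma> = \<beta> \<longleftrightarrow> \<gamma> = \<alpha> + \<beta>" for \<gamma>
    by (metis add.commute diff_eq_eq minus_add_distrib uminus_add_conv_diff)
  then show ?case by (cases k) (auto simp: mult_single lookup_single when_def)
qed (simp_all add: distrib_left lookup_add)

text \<open>Multiplication by \<open>v\<close> moves the exponent \<alpha> of \<open>u\<close> to 0.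
  At group exponent 0 the operator \<open>D2\<close> - 2 multiplies the coefficient of the highest
  \<open>j\<close> by -2, so this term survives, and 0 is not
  \<open>\<sigma>\<^sub>1\<close>.\<close>

lemma br_shift_not_in_Z:
  assumes "D1 u = scale a u" "a \<noteq> 0" "(\<alpha>, i, j) \<in> keys u"
  defines "v \<equiv> single (- \<alpha>, 0, 0) 1"
  shows "D1 (br v u) = 0" "br v u \<notin> Z"
proof -
  note \<alpha> = d1_eigenvector_keys[OF assms(1,3)]
  define g where "g = v * u"
  have v: "D1 v = scale (- a) v" by (simp add: v_def d1_single \<alpha>)
  have br: "br v u = scale (- a) (D2 g - scale 2 g)"
    unfolding g_def by (rule br_opposite_weight[OF assms(1) v])
  have "D1 g = 0" unfolding g_def by (simp add: assms(1) v derivation)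
  then show "D1 (br v u) = 0"
    unfolding br by (simp only: d1_linear d1_d2_commute d2_zero scale.scale_zero_right diff_self)
  have fin: "finite {j. (0, 0, j) \<in> keys g}"
    by (rule finite_subset[of _ "(snd \<circ> snd) ` keys g"]) (force intro: image_eqI)+
  define m where "m = Max {j. (0, 0, j) \<in> keys g}"
  have "j \<in> {j. (0, 0, j) \<in> keys g}"
    using assms(3) \<alpha> by (simp add: g_def v_def in_keys_iff lookup_shift)
  then have "m \<in> {j. (0, 0, j) \<in> keys g}"
    unfolding m_def by (intro Max_in[OF fin]) auto
  moreover have "(0, 0, Suc m) \<notin> keys g"
    using Max_ge[OF fin, of "Suc m"] by (auto simp flip: m_def)
  ultimately have "(0, 0, m) \<in> keys (br v u)"
    using \<open>a \<noteq> 0\<close> by (simp add: br in_keys_iff lookup_d2 lookup_minus)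
  then show "br v u \<notin> Z" by (auto simp: Z_def is_sigma_def)
qed

end

section \<open>Ideals properly containing the centre\<close>

text \<open>\<open>K\<close> stands for the preimage of a nonzero ideal of the image of
  \<open>M\<close> in the quotient; the aim is \<open>ideal_eq\<close>.\<close>

locale block_ideal = block_algebra +
  fixes K :: "('a \<times> nat \<times> nat \<Rightarrow>\<^sub>0 'b) set"
  assumes subspace_K: "scale.subspace K"
    and Z_subset: "Z \<subseteq> K" and K_subset: "K \<subseteq> M"
    and ideal: "\<And>u v. v \<in> M \<Longrightarrow> u \<in> K \<Longrightarrow> br v u \<in> K"
    and K_neq: "K \<noteq> Z"
begin

section \<open>From a noncentral element to a noncentral \<open>D1\<close>-constant\<close>

lemma K_A: "u \<in> K \<Longrightarrow> u \<in> A"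
  using K_subset M_subset_A by blast

lemma d1_in_K: "u \<in> K \<Longrightarrow> D1 u \<in> K"
  using ideal[OF one_in_M] by (simp add: br_one_left)

text \<open>For a nonzero eigenvalue, the monomial inverse to one in the support of \<open>u\<close>
  has nonzero weight, hence lies in \<open>M\<close>, and \<open>br_shift_not_in_Z\<close>
  applies.\<close>

lemma eigenvector_imp_constant:
  assumes "u \<in> K" "u \<notin> Z" "D1 u = scale a u"
  shows "\<exists>f\<in>K. f \<notin> Z \<and> D1 f = 0"
proof (cases "a = 0")
  case True
  then show ?thesis using assms by auto
next
  case False
  have "u \<noteq> 0" using assms(2) scale.subspace_0[OF subspace_Z] by metis
  then obtain k where k: "k \<in> keys u" by (metis keys_eq_empty all_not_in_conv)
  obtain \<alpha> i j where \<alpha>: "k = (\<alpha>, i, j)" by (cases k)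
  note * = br_shift_not_in_Z[OF assms(3) False k[unfolded \<alpha>]]
  have "\<phi>1 (- \<alpha>) \<noteq> 0" using d1_eigenvector_keys(1)[OF assms(3) k[unfolded \<alpha>]] False by simp
  then have "single (- \<alpha>, 0, 0) 1 \<in> M"
    using zero_in_J by (intro single_in_M good_if_nonzero_weight)
  then show ?thesis using * ideal[OF _ assms(1)] by blast
qed

text \<open>When \<open>D1 u - a u\<close> is already central, either \<open>a \<noteq> 0\<close> and a central correction makes \<open>u\<close> an
  eigenvector, or \<open>D1 u\<close> is a multiple of \<open>x\<^bsup>\<sigma>\<^sub>1\<^esup>\<close>, and the bracket with \<open>x\<^bsup>-\<sigma>\<^sub>1\<^esup>\<close> gives a scalar.\<close>

lemma exists_d1_constant: "\<exists>f\<in>K. f \<notin> Z \<and> D1 f = 0"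
proof -
  have "u \<in> K \<Longrightarrow> u \<notin> Z \<Longrightarrow> ?thesis" for u
    using split_annihilated_d1[of u \<phi>1]
  proof (induction u rule: split_annihilated.induct)
    case zero
    then show ?case using scale.subspace_0[OF subspace_Z] by simp
  next
    case (step u a)
    define w where "w = D1 u - scale a u"
    have "w \<in> K"
      unfolding w_def using step.prems d1_in_K subspace_K
      by (intro scale.subspace_diff scale.subspace_scale)
    show ?case
    proof (cases "w \<in> Z")
      case False
      then show ?thesis using step.IH \<open>w \<in> K\<close> by (simp add: w_def)
    next
      case True
      then have dw: "D1 w = 0" "D2 w = w" by (simp_all add: Z_iff)
      have du: "D1 u = scale a u + w" by (simp add: w_def)
      show ?thesis
      proof (cases "a = 0")
        case False
        let ?u = "u + scale (1 / a) w"
        have "scale (1 / a) w \<in> Z" using True subspace_Z by (simp add: scale.subspace_scale)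
        then have "?u \<in> K" "?u \<notin> Z"
          using step.prems Z_subset scale.subspace_add[OF subspace_K]
            scale.subspace_diff[OF subspace_Z, of ?u "scale (1 / a) w"] by auto
        moreover have "D1 ?u = scale a ?u"
          using False by (simp add: d1_linear dw du scale.scale_right_distrib)
        ultimately show ?thesis by (rule eigenvector_imp_constant)
      next
        case a: True
        show ?thesis
        proof (cases "w = 0")
          case True
          then show ?thesis using step.prems a du by auto
        next
          case False
          then obtain k where k: "k \<in> keys w" by (metis keys_eq_empty all_not_in_conv)
          then obtain \<sigma> where \<sigma>: "k = (\<sigma>, 0, 0)" "\<phi>1 \<sigma> = 0" "\<phi>2 \<sigma> = 1"
            using \<open>w \<in> Z\<close> by (auto simp: Z_def is_sigma_def)
          define v :: "'a \<times> nat \<times> nat \<Rightarrow>\<^sub>0 'b" where "v = single (- \<sigma>, 0, 0) 1"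
          have "(- \<sigma>, 0, 0) \<in> good"
            using \<sigma> zero_in_J by (simp add: good_def)
          then have "v \<in> M" unfolding v_def by (rule single_in_M)
          have "D1 v = 0" "D2 v = - v" using \<sigma> by (simp_all add: v_def d1_single d2_single single_uminus)
          then have br: "br v u = scale 2 (v * w)"
            using scale.scale_left_distrib[of 1 1 "v * w"]
            by (simp add: br_eq du a algebra_simps)
          have "lookup (v * w) (0, 0, 0) \<noteq> 0"
            using k \<sigma> by (simp add: v_def lookup_shift in_keys_iff)
          then have "(0, 0, 0) \<in> keys (br v u)"
            by (simp add: br in_keys_iff)
          then have "br v u \<notin> Z" by (auto simp: Z_def is_sigma_def)
          moreover have "D1 (br v u) = 0"
            unfolding br by (simp add: d1_scale derivation dw \<open>D1 v = 0\<close>)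
          ultimately show ?thesis using ideal[OF \<open>v \<in> M\<close> step.prems(1)] by blast
        qed
      qed
    qed
  qed
  then show ?thesis using K_neq Z_subset by blast
qed

section \<open>The associative ideal of multipliers\<close>

text \<open>The multipliers form an associative ideal of the algebra of \<open>D1\<close>-constants. Stability under \<open>D2\<close>
  comes from \<open>[v, D1 w h] = D1 v D1 w D2 h + [v, D1 w] h\<close>.\<close>

definition multipliers where
  "multipliers = {h \<in> A. D1 h = 0 \<and> (\<forall>v\<in>A. D1 v * h \<in> K)}"

lemma multipliersI:
  assumes "h \<in> A" "D1 h = 0"
    and mono: "\<And>\<alpha> i j c. i \<in> J1 \<Longrightarrow> j \<in> J2 \<Longrightarrow> D1 (single (\<alpha>, i, j) c) * h \<in> K"
  shows "h \<in> multipliers"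
proof -
  have "D1 v * h \<in> K" if "v \<in> A" for v
  proof -
    have "keys v \<subseteq> UNIV \<times> J1 \<times> J2" using that by (simp add: A_def)
    then show ?thesis
    proof (induction v rule: poly_mapping_keys_induct)
      case (single k c)
      then show ?case using mono by (cases k) simp
    qed (simp_all add: scale.subspace_0[OF subspace_K] d1_add distrib_right
        scale.subspace_add[OF subspace_K])
  qed
  then show ?thesis using assms(1,2) by (simp add: multipliers_def)
qed

text \<open>A \<open>D1\<close>-constant \<open>g\<close> can be moved under the derivation:
  \<open>D1 v * g\<close> is \<open>D1 (v * g)\<close>.\<close>

lemma multipliers_mult:
  assumes "h \<in> multipliers" "g \<in> A" "D1 g = 0"
  shows "g * h \<in> multipliers"
proof -
  have "D1 v * (g * h) \<in> K" if "v \<in> A" for v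
  proof -
    have "D1 v * (g * h) = D1 (v * g) * h" using assms(3) by (simp add: derivation mult.assoc)
    then show ?thesis using assms(1) mult_in_A[OF that assms(2)] by (simp add: multipliers_def)
  qed
  then show ?thesis
    using assms by (simp add: multipliers_def mult_in_A derivation)
qed

text \<open>\<open>d1_monomial_factor\<close> supplies \<open>v\<close> and \<open>w\<close> for
  each monomial in such a way that the correction [v, D1 w] is again in the image of
  \<open>D1\<close>, hence is multiplied into \<open>K\<close> by \<open>h\<close>.\<close>

lemma d2_in_multipliers:
  assumes h: "h \<in> multipliers"
  shows "D2 h \<in> multipliers"
proof (rule multipliersI)
  show "D2 h \<in> A" using h by (simp add: multipliers_def d2_in_A)
  show "D1 (D2 h) = 0" using h by (simp add: multipliers_def d1_d2_commute)
next
  fix \<alpha> i j c assume "i \<in> J1" "j \<in> J2"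
  from d1_monomial_factor[OF this, of \<alpha> c] obtain v w q
    where vwq: "v \<in> M" "w \<in> A" "q \<in> A" "D1 v * D1 w = D1 (single (\<alpha>, i, j) c)" "br v (D1 w) = D1 q"
    by blast
  have dh: "D1 h = 0" and K: "D1 w * h \<in> K" "D1 q * h \<in> K"
    using h vwq by (simp_all add: multipliers_def)
  have "br v (D1 w * h) = D1 v * D1 w * D2 h + br v (D1 w) * h"
    by (simp add: br_eq derivation dh algebra_simps)
  then have "D1 (single (\<alpha>, i, j) c) * D2 h = br v (D1 w * h) - D1 q * h"
    by (simp add: vwq)
  then show "D1 (single (\<alpha>, i, j) c) * D2 h \<in> K"
    using ideal[OF vwq(1) K(1)] K(2) scale.subspace_diff[OF subspace_K] by simp
qed

lemma multipliers_diff_scale: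
  assumes "g \<in> multipliers" "h \<in> multipliers"
  shows "g - scale c h \<in> multipliers"
  using assms subspace_A subspace_K
  by (simp add: multipliers_def scale.subspace_diff scale.subspace_scale d1_linear right_diff_distrib)

text \<open>A noncentral \<open>D1\<close>-constant \<open>f\<close> in \<open>K\<close> gives
  \<open>D2 f - f\<close>, since the bracket of \<open>v\<close> with \<open>f\<close> is
  \<open>D1 v\<close> times this element.\<close>

lemma exists_multiplier: "\<exists>h\<in>multipliers. h \<noteq> 0"
proof -
  obtain f where f: "f \<in> K" "f \<notin> Z" "D1 f = 0" using exists_d1_constant by blast
  have "D2 f - f \<in> multipliers"
  proof (rule multipliersI)
    show "D2 f - f \<in> A" using K_A[OF f(1)] by (simp add: d2_in_A scale.subspace_diff[OF subspace_A])
    show "D1 (D2 f - f) = 0" using f(3) by (simp add: d1_diff d1_d2_commute)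
  next
    fix \<alpha> i j c assume ij: "i \<in> J1" "j \<in> J2"
    let ?v = "single (\<alpha>, i, j) c :: 'a \<times> nat \<times> nat \<Rightarrow>\<^sub>0 'b"
    show "D1 ?v * (D2 f - f) \<in> K"
    proof (cases "(\<alpha>, i, j) \<in> good")
      case True
      from ideal[OF single_in_M[OF True] f(1)] show ?thesis by (simp add: br_eq f(3))
    next
      case False
      then have "D1 ?v = 0" using ij by (auto simp: good_def d1_single)
      then show ?thesis by (simp add: scale.subspace_0[OF subspace_K])
    qed
  qed
  moreover have "D2 f - f \<noteq> 0" using f K_A by (simp add: Z_iff)
  ultimately show ?thesis by blast
qed

text \<open>Factors of \<open>D2\<close> are applied until the next one would give 0. What remains
  is a joint eigenvector, so by \<open>kernelsD\<close> its support is a single exponent without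
  polynomial part. The inverse monomial is also a \<open>D1\<close>-constant, and the product is
  1.\<close>

lemma one_in_multipliers: "1 \<in> multipliers"
proof -
  have "h \<in> multipliers \<Longrightarrow> h \<noteq> 0 \<Longrightarrow> ?thesis" for h
    using split_annihilated_d2[of h \<phi>2]
  proof (induction h rule: split_annihilated.induct)
    case (step h b)
    show ?case
    proof (cases "D2 h - scale b h = 0")
      case False
      then show ?thesis
        using step.IH step.prems by (simp add: multipliers_diff_scale d2_in_multipliers)
    next
      case True
      then have dh: "D1 h = scale 0 h" "D2 h = scale b h"
        using step.prems by (simp_all add: multipliers_def)
      obtain k where k: "k \<in> keys h" using step.prems by (metis keys_eq_empty all_not_in_conv)
      obtain \<beta> i j where \<beta>: "k = (\<beta>, i, j)" by (cases k)
      note key = d1_eigenvector_keys[OF dh(1)] d2_eigenvector_keys[OF dh(2)]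
      have keys: "l = (\<beta>, 0, 0)" if "l \<in> keys h" for l
      proof -
        obtain \<gamma> m n where l: "l = (\<gamma>, m, n)" by (cases l)
        show ?thesis
          using key[OF that[unfolded l]] key[OF k[unfolded \<beta>]] by (auto simp: l intro: kernelsD)
      qed
      define c where "c = lookup h (\<beta>, 0, 0)"
      have h: "h = single (\<beta>, 0, 0) c"
      proof (rule poly_mapping_eqI)
        fix l show "lookup h l = lookup (single (\<beta>, 0, 0) c) l"
          using keys[of l] by (auto simp: c_def lookup_single when_def in_keys_iff)
      qed
      have "c \<noteq> 0" using h step.prems(2) by auto
      have "D1 (single (- \<beta>, 0, 0) (1 / c)) = 0"
        using key(1)[OF k[unfolded \<beta>]] by (simp add: d1_single)
      then have "single (- \<beta>, 0, 0) (1 / c) * h \<in> multipliers"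
        using zero_in_J by (intro multipliers_mult step.prems single_in_A)
      then show ?thesis
        using \<open>c \<noteq> 0\<close> by (simp add: h mult_single one_eq_single)
    qed
  qed simp
  then show ?thesis using exists_multiplier by blast
qed

lemma d1_A_subset_K: "v \<in> A \<Longrightarrow> D1 v \<in> K"
  using one_in_multipliers by (auto simp: multipliers_def)

theorem ideal_eq: "K = M"
proof (cases "J1 = {0}")
  case False
  then have "A \<subseteq> K" using d1_surj_A d1_A_subset_K J1 by fastforce
  then show ?thesis using K_subset M_subset_A by blast
next
  case True
  then obtain \<beta> where \<beta>: "\<phi>1 \<beta> \<noteq> 0" using exists_nonzero_weight by blast
  \<comment> \<open>The product \<open>w * u\<close> has nonzero weight, so it lies in the image of
    \<open>D1\<close> and hence in \<open>K\<close>. Its bracket with the inverse \<open>v\<close>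
    of \<open>w\<close> is a nonzero multiple of \<open>D2 u - scale 2 u\<close>.\<close>
  have const: "D2 u - scale 2 u \<in> K" if u: "u \<in> A" "D1 u = 0" for u
  proof -
    define v w :: "'a \<times> nat \<times> nat \<Rightarrow>\<^sub>0 'b" where "v = single (- \<beta>, 0, 0) 1" and "w = single (\<beta>, 0, 0) 1"
    have "v \<in> M"
      unfolding v_def using \<beta> zero_in_J by (intro single_in_M good_if_nonzero_weight) simp_all
    have "w \<in> A" unfolding w_def using zero_in_J by (intro single_in_A)
    have dv: "D1 v = scale (- \<phi>1 \<beta>) v" and dw: "D1 w = scale (\<phi>1 \<beta>) w"
      by (simp_all add: v_def w_def d1_single)
    have wu: "D1 (w * u) = scale (\<phi>1 \<beta>) (w * u)" by (simp add: derivation dw u)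
    have vwu: "v * (w * u) = u"
    proof -
      have "v * w = 1" by (simp add: v_def w_def mult_single one_eq_single)
      then show ?thesis by (simp flip: mult.assoc)
    qed
    have "D1 (scale (1 / \<phi>1 \<beta>) (w * u)) \<in> K"
      using \<open>w \<in> A\<close> u by (intro d1_A_subset_K scale.subspace_scale[OF subspace_A] mult_in_A)
    then have "w * u \<in> K" using \<beta> by (simp add: d1_scale wu)
    then have "br v (w * u) \<in> K" by (rule ideal[OF \<open>v \<in> M\<close>])
    then have "scale (- \<phi>1 \<beta>) (D2 u - scale 2 u) \<in> K"
      unfolding br_opposite_weight[OF wu dv] vwu .
    from scale.subspace_scale[OF subspace_K this, of "- 1 / \<phi>1 \<beta>"]
    show ?thesis using \<beta> by simp
  qed
  have "single k c \<in> K" if k: "k \<in> good" for k c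
  proof -
    obtain \<gamma> i j where \<gamma>: "k = (\<gamma>, i, j)" by (cases k)
    have i: "i = 0" and j: "j \<in> J2" using k True unfolding \<gamma> good_def by simp_all
    show ?thesis
    proof (cases "\<phi>1 \<gamma> = 0")
      case True
      show ?thesis
        unfolding \<gamma> i by (rule d2_minus_2_monomial[OF \<open>J1 = {0}\<close> k[unfolded \<gamma> i] True subspace_K const])
    next
      case False
      have "D1 (single k (c / \<phi>1 \<gamma>)) \<in> K"
        unfolding \<gamma> i using j zero_in_J by (intro d1_A_subset_K single_in_A)
      then show ?thesis using False by (simp add: \<gamma> i d1_single)
    qed
  qed
  note single = this
  have "u \<in> K" if "u \<in> M" for u
    using that[unfolded M_def mem_Collect_eq]
    by (induction u rule: poly_mapping_keys_induct)
      (simp_all add: single scale.subspace_0[OF subspace_K] scale.subspace_add[OF subspace_K])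
  then show ?thesis using K_subset by blast
qed

end

section \<open>The quotient by the centre\<close>

context block_algebra
begin

section \<open>The records of the statement in terms of the concrete spaces\<close>

abbreviation "R \<equiv> field_of TYPE('k)"
abbreviation "L \<equiv> A2 \<phi>1 \<phi>2 J1 J2"

lemma R_simps: "carrier R = UNIV" "add R = (+)" "mult R = (*)" "\<one>\<^bsub>R\<^esub> = 1" "\<zero>\<^bsub>R\<^esub> = 0"
  by (simp_all add: field_of_def)

lemma L_simps:
  "carrier L = A" "add L = (+)" "\<zero>\<^bsub>L\<^esub> = 0" "smult L = scale" "bracket L = br"
  by (simp_all add: A2_def A_def)

lemma is_sigma_unique: "is_sigma \<phi>1 \<phi>2 n \<sigma> \<Longrightarrow> is_sigma \<phi>1 \<phi>2 n \<tau> \<Longrightarrow> \<tau> = \<sigma>"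
  by (auto simp: is_sigma_def intro: kernelsD)

lemma xsigma_eq: "is_sigma \<phi>1 \<phi>2 n \<sigma> \<Longrightarrow> xsigma \<phi>1 \<phi>2 n = single (\<sigma>, 0, 0) 1"
proof -
  assume \<sigma>: "is_sigma \<phi>1 \<phi>2 n \<sigma>"
  then have "(THE \<tau>. is_sigma \<phi>1 \<phi>2 n \<tau>) = \<sigma>"
    using is_sigma_unique by (intro the_equality) blast+
  then show ?thesis using \<sigma> unfolding xsigma_def xmon_def by auto
qed

lemma xsigma_in_A: "xsigma \<phi>1 \<phi>2 n \<in> A"
proof (cases "\<exists>\<sigma>. is_sigma \<phi>1 \<phi>2 n \<sigma>")
  case True
  then show ?thesis using zero_in_J by (auto simp: xsigma_eq intro: single_in_A)
next
  case False
  then show ?thesis by (simp add: xsigma_def scale.subspace_0[OF subspace_A])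
qed

text \<open>Uniqueness of \<open>\<sigma>\<^sub>1\<close> makes the support condition that of a
  single monomial; if it does not exist, both sides are zero.\<close>

lemma center_line_eq: "center_line \<phi>1 \<phi>2 = Z"
proof (cases "\<exists>\<sigma>. is_sigma \<phi>1 \<phi>2 1 \<sigma>")
  case True
  then obtain \<sigma> where \<sigma>: "is_sigma \<phi>1 \<phi>2 1 \<sigma>" by blast
  have set: "{(\<tau>, 0::nat, 0::nat) | \<tau>. is_sigma \<phi>1 \<phi>2 1 \<tau>} = {(\<sigma>, 0, 0)}"
    using \<sigma> is_sigma_unique by auto
  have "u \<in> range (\<lambda>c. single (\<sigma>, 0, 0) c)" if "keys u \<subseteq> {(\<sigma>, 0, 0)}" for u :: "'g \<times> nat \<times> nat \<Rightarrow>\<^sub>0 'k"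
  proof (rule range_eqI, rule poly_mapping_eqI)
    show "lookup u k = lookup (single (\<sigma>, 0, 0) (lookup u (\<sigma>, 0, 0))) k" for k
      using that by (cases "k = (\<sigma>, 0, 0)") (auto simp: lookup_single in_keys_iff)
  qed
  then show ?thesis
    unfolding center_line_def Z_def set xsigma_eq[OF \<sigma>] scale_single
    by (auto split: if_splits)
next
  case False
  then have "Z = {0}" by (auto simp: Z_def)
  then show ?thesis using False by (auto simp: center_line_def xsigma_def)
qed

lemma lie_algebra_L: "lie_algebra R L"
proof -
  interpret R: field R by (rule field_field_of)
  note A_closed = scale.subspace_add[OF subspace_A] scale.subspace_0[OF subspace_A]
    scale.subspace_scale[OF subspace_A]
  interpret L: module R L
  proof (rule moduleI)
    show "cring R" ..
    show "abelian_group L"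
    proof (rule abelian_groupI; unfold L_simps)
      fix x assume "x \<in> A"
      then show "\<exists>y\<in>A. y + x = 0" by (intro bexI[of _ "- x"] scale.subspace_neg[OF subspace_A]) auto
    qed (auto simp: A_closed algebra_simps)
  qed (auto simp: L_simps R_simps A_closed scale.scale_left_distrib scale.scale_right_distrib)
  show ?thesis
    by unfold_locales (simp_all add: L_simps R_simps br_in_A br_add_left br_add_right br_scale_left
        br_scale_right br_self br_jacobi)
qed

lemma submodule_L_iff: "submodule S R L \<longleftrightarrow> scale.subspace S \<and> S \<subseteq> A"
proof -
  interpret lie_algebra R L by (rule lie_algebra_L)
  show ?thesis unfolding submodule_iff scale.subspace_def L_simps R_simps by auto
qed

sublocale LQ: lie_algebra_ideal R L Z
proof (intro lie_algebra_ideal.intro lie_algebra_ideal_axioms.intro lie_algebra_L)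
  show "lie_ideal Z R L"
    unfolding lie_ideal_def submodule_L_iff
    using subspace_Z Z_subset_M M_subset_A
    by (auto simp: L_simps br_Z scale.subspace_0[OF subspace_Z])
qed

lemma B2_eq: "B2 \<phi>1 \<phi>2 J1 J2 = LQ.Q"
  by (simp add: B2_def center_line_eq)

lemma B2_class_eq: "B2_class \<phi>1 \<phi>2 J1 J2 u = LQ.cls u"
  by (simp add: B2_class_def center_line_eq)

section \<open>Simplicity of the image of \<open>M\<close>, and the derived algebra\<close>

lemma submodule_M: "submodule M R L"
  using subspace_M M_subset_A by (simp add: submodule_L_iff)

lemma M_nonabelian: "\<exists>x\<in>M. \<exists>y\<in>M. br x y \<notin> Z"
  using exists_d1_not_in_Z one_in_M by (metis br_one_left)

lemma subideal_cases:
  assumes "submodule K R L" "Z \<subseteq> K" "K \<subseteq> M" "\<And>u v. v \<in> M \<Longrightarrow> u \<in> K \<Longrightarrow> br v u \<in> K"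
  shows "K = Z \<or> K = M"
proof (rule disjCI)
  assume "K \<noteq> M"
  show "K = Z"
  proof (rule ccontr)
    assume "K \<noteq> Z"
    then interpret block_ideal \<phi>1 \<phi>2 J1 J2 K
      using assms by unfold_locales (auto simp: submodule_L_iff)
    show False using ideal_eq \<open>K \<noteq> M\<close> by simp
  qed
qed

text \<open>Covers both cases of the theorem: the image of \<open>M\<close> is all of the quotient
  if \<open>M = A\<close>, and it always is the derived algebra.\<close>

lemma simple_image_M: "simple_lie_algebra R (B2 \<phi>1 \<phi>2 J1 J2 \<lparr>carrier := LQ.cls ` M\<rparr>)"
  unfolding B2_eq
proof (rule LQ.simple_quotient)
  fix K assume "submodule K R L" "Z \<subseteq> K" "K \<subseteq> M"
    "\<And>x y. x \<in> M \<Longrightarrow> y \<in> K \<Longrightarrow> bracket L x y \<in> K"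
  then show "K = Z \<or> K = M" by (intro subideal_cases) (auto simp: L_simps)
qed (use Z_subset_M M_nonabelian M_subset_A in \<open>auto simp: submodule_M L_simps intro: br_in_M\<close>)

text \<open>One inclusion is \<open>br_in_M\<close>. Conversely, if a subspace contains all
  brackets, then its preimage in \<open>M\<close> is an ideal above \<open>Z\<close>, different from
  \<open>Z\<close> by \<open>M_nonabelian\<close>, and so equal to \<open>M\<close>.\<close>

lemma lie_derived_B2: "lie_derived R (B2 \<phi>1 \<phi>2 J1 J2) = LQ.cls ` M"
proof
  have "submodule (LQ.cls ` M) R LQ.Q" by (rule LQ.submodule_cls_image[OF submodule_M])
  moreover have "bracket LQ.Q X Y \<in> LQ.cls ` M" if "X \<in> carrier LQ.Q" "Y \<in> carrier LQ.Q" for X Y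
    using that by (auto simp: LQ.carrier_Q LQ.bracket_Q) (auto simp: L_simps intro: br_in_M)
  ultimately show "lie_derived R (B2 \<phi>1 \<phi>2 J1 J2) \<subseteq> LQ.cls ` M"
    unfolding lie_derived_def B2_eq by blast
next
  have "LQ.cls ` M \<subseteq> H"
    if H: "submodule H R LQ.Q" "\<forall>X\<in>carrier LQ.Q. \<forall>Y\<in>carrier LQ.Q. bracket LQ.Q X Y \<in> H" for H
  proof -
    interpret Q: lie_algebra R LQ.Q by (rule LQ.lie_algebra_Q)
    have br_H: "LQ.cls (br x y) \<in> H" if "x \<in> A" "y \<in> A" for x y
    proof -
      have "LQ.cls x \<in> carrier LQ.Q" "LQ.cls y \<in> carrier LQ.Q"
        using that by (auto simp: LQ.carrier_Q L_simps)
      then show ?thesis using H(2) that by (metis LQ.bracket_Q L_simps(1,5))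
    qed
    have A: "u \<in> M \<Longrightarrow> u \<in> A" for u using M_subset_A by blast
    define K where "K = {x \<in> M. LQ.cls x \<in> H}"
    have "Z \<in> H"
      using H(1) unfolding Q.submodule_iff LQ.zero_Q LQ.cls_zero by blast
    then have "Z \<subseteq> K"
      using Z_subset_M A by (auto simp: K_def LQ.cls_eq_I_iff[THEN iffD2] L_simps)
    moreover have "submodule K R L"
      unfolding K_def by (rule LQ.submodule_vimage_cls[OF submodule_M H(1)])
    moreover have "br v u \<in> K" if "v \<in> M" "u \<in> K" for u v
      using that A br_H br_in_M by (auto simp: K_def)
    ultimately have "K = Z \<or> K = M"
      by (intro subideal_cases) (auto simp: K_def)
    moreover have "K \<noteq> Z"
    proof -
      obtain x y where "x \<in> M" "y \<in> M" "br x y \<notin> Z" using M_nonabelian by blast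
      then show ?thesis using A br_H br_in_M by (auto simp: K_def)
    qed
    ultimately show ?thesis by (auto simp: K_def)
  qed
  then show "LQ.cls ` M \<subseteq> lie_derived R (B2 \<phi>1 \<phi>2 J1 J2)"
    unfolding lie_derived_def B2_eq by blast
qed

section \<open>The excluded exponent and the direct sum\<close>

lemma M_eq_A:
  assumes "J1 \<times> J2 \<noteq> {(0, 0)} \<or> \<not> (\<exists>\<sigma>. is_sigma \<phi>1 \<phi>2 2 \<sigma>)"
  shows "M = A"
proof -
  have "good = UNIV \<times> J1 \<times> J2"
    using assms by (auto simp: good_def is_sigma_def)
  then show ?thesis by (simp add: M_def A_def)
qed

text \<open>The second summand vanishes, because its representative lies in
  \<open>Z\<close>.\<close>

lemma sigma_span_eq:
  "sigma_span \<phi>1 \<phi>2 J1 J2 = LQ.cls ` range (\<lambda>a. scale a (xsigma \<phi>1 \<phi>2 2))"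
proof -
  have "smult LQ.Q a (LQ.cls (xsigma \<phi>1 \<phi>2 2)) \<oplus>\<^bsub>LQ.Q\<^esub> smult LQ.Q b (LQ.cls (xsigma \<phi>1 \<phi>2 1)) =
      LQ.cls (scale a (xsigma \<phi>1 \<phi>2 2))" for a b
  proof -
    note A = xsigma_in_A scale.subspace_scale[OF subspace_A xsigma_in_A]
    have Z: "scale b (xsigma \<phi>1 \<phi>2 1) \<in> Z"
      unfolding center_line_eq[symmetric] center_line_def by blast
    have "smult LQ.Q a (LQ.cls (xsigma \<phi>1 \<phi>2 2)) \<oplus>\<^bsub>LQ.Q\<^esub> smult LQ.Q b (LQ.cls (xsigma \<phi>1 \<phi>2 1)) =
        LQ.cls (scale a (xsigma \<phi>1 \<phi>2 2) + scale b (xsigma \<phi>1 \<phi>2 1))"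
      using LQ.smult_Q[of a "xsigma \<phi>1 \<phi>2 2"] LQ.smult_Q[of b "xsigma \<phi>1 \<phi>2 1"]
        LQ.add_Q[of "scale a (xsigma \<phi>1 \<phi>2 2)" "scale b (xsigma \<phi>1 \<phi>2 1)"]
      by (simp add: L_simps R_simps A)
    also have "\<dots> = LQ.cls (scale a (xsigma \<phi>1 \<phi>2 2))"
      using LQ.cls_absorb[OF Z, of "scale a (xsigma \<phi>1 \<phi>2 2)"]
      by (simp add: L_simps A add.commute)
    finally show ?thesis .
  qed
  then show ?thesis unfolding sigma_span_def B2_eq B2_class_eq by auto
qed

text \<open>Here \<open>\<sigma>\<^sub>2\<close> is the only exponent of \<open>A\<close> that is
  not good, so splitting off its term gives the decomposition. As \<open>M\<close> contains
  \<open>Z\<close>, the intersection can be computed before passing to classes.\<close>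

lemma direct_sum_B2:
  assumes J: "J1 = {0}" "J2 = {0}" and \<sigma>: "is_sigma \<phi>1 \<phi>2 2 \<sigma>"
  shows "is_direct_sum R (B2 \<phi>1 \<phi>2 J1 J2) (LQ.cls ` M) (sigma_span \<phi>1 \<phi>2 J1 J2)"
proof -
  let ?V = "range (\<lambda>a. single (\<sigma>, 0, 0) a :: 'g \<times> nat \<times> nat \<Rightarrow>\<^sub>0 'k)"
  have span: "sigma_span \<phi>1 \<phi>2 J1 J2 = LQ.cls ` ?V"
    by (simp add: sigma_span_eq xsigma_eq[OF \<sigma>])
  have "scale.subspace ?V"
    by (auto simp: scale.subspace_def simp flip: single_add intro: range_eqI[of _ _ 0])
  moreover have V_A: "?V \<subseteq> A" using zero_in_J by (auto intro: single_in_A)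
  ultimately have V: "submodule ?V R L" by (simp add: submodule_L_iff)
  have not_good: "(\<sigma>, 0, 0) \<notin> good" using \<sigma> J unfolding good_def is_sigma_def by simp
  have "LQ.cls u \<in> LQ.cls ` M <+>\<^bsub>LQ.Q\<^esub> LQ.cls ` ?V" if u: "u \<in> A" for u
  proof -
    define v :: "'g \<times> nat \<times> nat \<Rightarrow>\<^sub>0 'k" where "v = single (\<sigma>, 0, 0) (lookup u (\<sigma>, 0, 0))"
    have "v \<in> A" using V_A by (auto simp: v_def)
    have "k \<in> good" if k: "k \<in> keys (u - v)" for k
    proof -
      obtain \<alpha> i j where \<alpha>: "k = (\<alpha>, i, j)" by (cases k)
      have "k \<noteq> (\<sigma>, 0, 0)" using k by (auto simp: v_def in_keys_iff lookup_minus)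
      then have "k \<in> keys u" using k
        by (auto simp: v_def in_keys_iff lookup_minus lookup_single when_def split: if_splits)
      then have "i \<in> J1" "j \<in> J2" using u unfolding A_def \<alpha> by auto
      then have "i = 0" "j = 0" using J by simp_all
      then have "\<not> is_sigma \<phi>1 \<phi>2 2 \<alpha>"
        using is_sigma_unique[OF \<sigma>] \<open>k \<noteq> (\<sigma>, 0, 0)\<close> \<alpha> by auto
      then show ?thesis
        using \<open>i = 0\<close> \<open>j = 0\<close> zero_in_J unfolding good_def \<alpha> is_sigma_def by simp
    qed
    then have "u - v \<in> M" by (auto simp: M_def)
    moreover have "LQ.cls u = LQ.cls (u - v) \<oplus>\<^bsub>LQ.Q\<^esub> LQ.cls v"
      using LQ.add_Q[of "u - v" v] \<open>v \<in> A\<close> \<open>u - v \<in> M\<close> M_subset_A by (auto simp: L_simps)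
    ultimately show ?thesis by (auto simp: set_add_def' v_def)
  qed
  moreover have "X \<oplus>\<^bsub>LQ.Q\<^esub> Y \<in> carrier LQ.Q" if "X \<in> LQ.cls ` M" "Y \<in> LQ.cls ` ?V" for X Y
  proof -
    interpret Q: lie_algebra R LQ.Q by (rule LQ.lie_algebra_Q)
    have "X \<in> carrier LQ.Q" "Y \<in> carrier LQ.Q"
      using that M_subset_A V_A unfolding LQ.carrier_Q L_simps by blast+
    then show ?thesis by simp
  qed
  ultimately have "carrier LQ.Q = LQ.cls ` M <+>\<^bsub>LQ.Q\<^esub> LQ.cls ` ?V"
    unfolding set_add_def' by (auto simp: LQ.carrier_Q L_simps)
  moreover have "LQ.cls ` M \<inter> LQ.cls ` ?V = {\<zero>\<^bsub>LQ.Q\<^esub>}"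
  proof -
    have "X = Z" if X: "X \<in> LQ.cls ` M" "X \<in> LQ.cls ` ?V" for X
    proof -
      obtain a where a: "X = LQ.cls (single (\<sigma>, 0, 0) a)" using X(2) by blast
      have "single (\<sigma>, 0, 0) a \<in> carrier L" using V_A unfolding L_simps by blast
      then have "single (\<sigma>, 0, 0) a \<in> M"
        using X(1) Z_subset_M unfolding a by (intro LQ.cls_mem_image[OF submodule_M])
      then have "a = 0" using not_good by (auto simp: M_def split: if_splits)
      then show ?thesis using a LQ.cls_zero by (simp add: L_simps)
    qed
    moreover have "Z \<in> LQ.cls ` S" if "submodule S R L" for S
    proof -
      have "0 \<in> S" using that scale.subspace_0 unfolding submodule_L_iff by blast
      then show ?thesis using LQ.cls_zero unfolding L_simps by blast
    qed
    ultimately show ?thesis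
      using V submodule_M unfolding LQ.zero_Q LQ.cls_zero by blast
  qed
  ultimately show ?thesis
    unfolding is_direct_sum_def span B2_eq
    using LQ.submodule_cls_image[OF submodule_M] LQ.submodule_cls_image[OF V] by blast
qed

end

theorem theorem1:
  fixes \<phi>1 \<phi>2 :: "'g::ab_group_add \<Rightarrow> 'k::field_char_0"
    and J1 J2 :: "nat set"
  assumes torsion_free: "\<And>(n::nat) (\<gamma>::'g). n > 0 \<Longrightarrow> (\<Sum>_<n. \<gamma>) = 0 \<Longrightarrow> \<gamma> = 0"
    and J1: "J1 \<in> {{0}, UNIV}"
    and J2: "J2 \<in> {{0}, UNIV}"
    and hom1: "Modules.additive \<phi>1"
    and hom2: "Modules.additive \<phi>2"
    and nonzero1: "J1 = {0} \<Longrightarrow> \<phi>1 \<noteq> (\<lambda>_. 0)"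
    and nonzero2: "J2 = {0} \<Longrightarrow> \<phi>2 \<noteq> (\<lambda>_. 0)"
    and kernels: "{\<gamma>. \<phi>1 \<gamma> = 0} \<inter> {\<gamma>. \<phi>2 \<gamma> = 0} = {0}"
  shows
    "(J1 \<times> J2 \<noteq> {(0, 0)} \<or> \<not> (\<exists>\<sigma>. is_sigma \<phi>1 \<phi>2 2 \<sigma>) \<longrightarrow>
        simple_lie_algebra (field_of TYPE('k)) (B2 \<phi>1 \<phi>2 J1 J2)) \<and>
     (J1 \<times> J2 = {(0, 0)} \<and> (\<exists>\<sigma>. is_sigma \<phi>1 \<phi>2 2 \<sigma>) \<longrightarrow>
        simple_lie_algebra (field_of TYPE('k))
          (lie_derived_algebra (field_of TYPE('k)) (B2 \<phi>1 \<phi>2 J1 J2)) \<and>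
        is_direct_sum (field_of TYPE('k)) (B2 \<phi>1 \<phi>2 J1 J2)
          (lie_derived (field_of TYPE('k)) (B2 \<phi>1 \<phi>2 J1 J2))
          (sigma_span \<phi>1 \<phi>2 J1 J2))"
proof -
  interpret block_algebra \<phi>1 \<phi>2 J1 J2
    using J1 J2 hom1 hom2 nonzero1 kernels by (rule block_algebra.intro)
  let ?a = "J1 \<times> J2 \<noteq> {(0, 0)} \<or> \<not> (\<exists>\<sigma>. is_sigma \<phi>1 \<phi>2 2 \<sigma>)"
  have "simple_lie_algebra R (B2 \<phi>1 \<phi>2 J1 J2)" if ?a
  proof -
    have "LQ.cls ` M = carrier (B2 \<phi>1 \<phi>2 J1 J2)"
      unfolding M_eq_A[OF that] B2_eq LQ.carrier_Q L_simps ..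
    then show ?thesis using simple_image_M by simp
  qed
  moreover have "simple_lie_algebra R (lie_derived_algebra R (B2 \<phi>1 \<phi>2 J1 J2))"
    unfolding lie_derived_algebra_def lie_derived_B2 by (rule simple_image_M)
  moreover have "is_direct_sum R (B2 \<phi>1 \<phi>2 J1 J2) (lie_derived R (B2 \<phi>1 \<phi>2 J1 J2))
      (sigma_span \<phi>1 \<phi>2 J1 J2)" if "\<not> ?a"
  proof -
    have "J1 \<times> J2 = {0} \<times> {0}" using that by simp
    then have "J1 = {0}" "J2 = {0}" unfolding times_eq_iff by auto
    then show ?thesis unfolding lie_derived_B2 using direct_sum_B2 that by blast
  qed
  ultimately show ?thesis by blast
qed

end
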